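(* Let $C$ and $D$ be coalgebras over a field $k$, let $\Psi: C\otimes D\to D\otimes C$ be a twist map satisfying the coassociativity condition, and let $Z: C\otimes D\to D\otimes C$ be a linear map. Then $\Psi$ is $Z$-conormal if and only if $$\varepsilon_Z:=(\varepsilon_D\otimes\varepsilon_C)\circ Z: C\otimes D\to k$$ is a counit for the twisted coproduct $\Delta_\Psi$, i.e. $(\varepsilon_Z\otimes\mathrm{id}_{C\otimes D})\Delta_\Psi=\mathrm{id}_{C\otimes D}=(\mathrm{id}_{C\otimes D}\otimes\varepsilon_Z)\Delta_\Psi$.
   Context: All coalgebras are coassociative and counital over the field $k$; Sweedler notation $\Delta(c)=c_{(1)}\otimes c_{(2)}$ is used. A twist map is a $k$-linear map $\Psi: C\otimes D\to D\otimes C$, and one writes $\Psi(c\otimes d)=d^{[\Psi]}\otimes c^{[\Psi]}$ (summation understood); similarly $Z(c\otimes d)=d^{[Z]}\otimes c^{[Z]}$. The twisted coproduct is $\Delta_\Psi:=(\mathrm{id}_C\otimes\Psi\otimes\mathrm{id}_D)\circ(\Delta_C\otimes\Delta_D)$. The coassociativity condition on $\Psi$ is $$(\mathrm{id}_D\otimes\mathrm{id}_C\otimes\Psi)(\mathrm{id}_D\otimes\Delta_C\otimes\mathrm{id}_D)(\Psi\otimes\mathrm{id}_D)(\mathrm{id}_C\otimes\Delta_D)=(\Psi\otimes\mathrm{id}_D\otimes\mathrm{id}_C)(\mathrm{id}_C\otimes\Delta_D\otimes\mathrm{id}_C)(\mathrm{id}_C\otimes\Psi)(\Delta_C\otimes\mathrm{id}_D).$$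 $\Psi$ is right $Z$-conormal if $\varepsilon_D((d^{[\Psi]})^{[Z]})\,\varepsilon_C((c_{(1)})^{[Z]})\,(c_{(2)})^{[\Psi]}=\varepsilon_D(d)\,c$ for all $c\in C$, $d\in D$, i.e. $(\varepsilon_D\otimes\varepsilon_C\otimes\mathrm{id}_C)(Z\otimes\mathrm{id}_C)(\mathrm{id}_C\otimes\Psi)(\Delta_C\otimes\mathrm{id}_D)=\mathrm{id}_C\otimes\varepsilon_D$. It is left $Z$-conormal if $\varepsilon_C((c^{[\Psi]})^{[Z]})\,\varepsilon_D((d_{(2)})^{[Z]})\,(d_{(1)})^{[\Psi]}=\varepsilon_C(c)\,d$ for all $c,d$, i.e. $(\mathrm{id}_D\otimes\varepsilon_D\otimes\varepsilon_C)(\mathrm{id}_D\otimes Z)(\Psi\otimes\mathrm{id}_D)(\mathrm{id}_C\otimes\Delta_D)=\varepsilon_C\otimes\mathrm{id}_D$. It is $Z$-conormal if it is both. *)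

theory Defs
  imports "Jordan_Normal_Form.Missing_VectorSpace" "HOL-Algebra.AbelCoset"
begin

section \<open>Tensor products of vector spaces\<close>

definition free_vs :: "('a, 'm) ring_scheme \<Rightarrow> 's set \<Rightarrow> ('a, 's \<Rightarrow> 'a) module" where
  "free_vs K S = (ring.func_space K S)
     \<lparr>carrier := {f \<in> S \<rightarrow>\<^sub>E carrier K. finite {x \<in> S. f x \<noteq> \<zero>\<^bsub>K\<^esub>}}\<rparr>"

definition free_gen :: "('a, 'm) ring_scheme \<Rightarrow> 's set \<Rightarrow> 's \<Rightarrow> ('s \<Rightarrow> 'a)" where
  "free_gen K S x = (\<lambda>y\<in>S. if y = x then \<one>\<^bsub>K\<^esub> else \<zero>\<^bsub>K\<^esub>)"

text \<open>The fields \<^const>\<open>monoid.mult\<close> and \<^const>\<open>one\<close> of a module record carry no meaning.\<close>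

definition quotient_vs :: "('a, 'v, 'n) module_scheme \<Rightarrow> 'v set \<Rightarrow> ('a, 'v set) module" where
  "quotient_vs V N =
     \<lparr>carrier = a_rcosets\<^bsub>V\<^esub> N, mult = undefined, one = undefined,
      zero = N, add = (\<lambda>X Y. X <+>\<^bsub>V\<^esub> Y), smult = (\<lambda>a X. \<Union>x\<in>X. N +>\<^bsub>V\<^esub> (a \<odot>\<^bsub>V\<^esub> x))\<rparr>"

definition ground_vs :: "('a, 'm) ring_scheme \<Rightarrow> ('a, 'a) module" where
  "ground_vs K =
     \<lparr>carrier = carrier K, mult = mult K, one = one K,
      zero = zero K, add = add K, smult = mult K\<rparr>"

definition tensor_rels ::
  "('a, 'm) ring_scheme \<Rightarrow> ('a, 'v, 'n) module_scheme \<Rightarrow> ('a, 'w, 'p) module_scheme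
    \<Rightarrow> ('v \<times> 'w \<Rightarrow> 'a) set" where
  "tensor_rels K V W =
     (let F = free_vs K (carrier V \<times> carrier W); e = free_gen K (carrier V \<times> carrier W) in
       {e (v \<oplus>\<^bsub>V\<^esub> v', w) \<ominus>\<^bsub>F\<^esub> (e (v, w) \<oplus>\<^bsub>F\<^esub> e (v', w))
          | v v' w. v \<in> carrier V \<and> v' \<in> carrier V \<and> w \<in> carrier W}
     \<union> {e (v, w \<oplus>\<^bsub>W\<^esub> w') \<ominus>\<^bsub>F\<^esub> (e (v, w) \<oplus>\<^bsub>F\<^esub> e (v, w'))
          | v w w'. v \<in> carrier V \<and> w \<in> carrier W \<and> w' \<in> carrier W}
     \<union> {e (a \<odot>\<^bsub>V\<^esub> v, w) \<ominus>\<^bsub>F\<^esub> a \<odot>\<^bsub>F\<^esub> e (v, w)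
          | a v w. a \<in> carrier K \<and> v \<in> carrier V \<and> w \<in> carrier W}
     \<union> {e (v, a \<odot>\<^bsub>W\<^esub> w) \<ominus>\<^bsub>F\<^esub> a \<odot>\<^bsub>F\<^esub> e (v, w)
          | a v w. a \<in> carrier K \<and> v \<in> carrier V \<and> w \<in> carrier W})"

definition tensor_null ::
  "('a, 'm) ring_scheme \<Rightarrow> ('a, 'v, 'n) module_scheme \<Rightarrow> ('a, 'w, 'p) module_scheme
    \<Rightarrow> ('v \<times> 'w \<Rightarrow> 'a) set" where
  "tensor_null K V W =
     LinearCombinations.module.span K (free_vs K (carrier V \<times> carrier W)) (tensor_rels K V W)"

type_synonym ('a, 'v, 'w) tensor = "('v \<times> 'w \<Rightarrow> 'a) set"

definition tensor_vs ::
  "('a, 'm) ring_scheme \<Rightarrow> ('a, 'v, 'n) module_scheme \<Rightarrow> ('a, 'w, 'p) module_scheme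
    \<Rightarrow> ('a, ('a, 'v, 'w) tensor) module" (infixl \<open>\<boxtimes>\<index>\<close> 70) where
  "V \<boxtimes>\<^bsub>K\<^esub> W = quotient_vs (free_vs K (carrier V \<times> carrier W)) (tensor_null K V W)"

definition pure_tensor ::
  "('a, 'm) ring_scheme \<Rightarrow> ('a, 'v, 'n) module_scheme \<Rightarrow> ('a, 'w, 'p) module_scheme
    \<Rightarrow> 'v \<Rightarrow> 'w \<Rightarrow> ('a, 'v, 'w) tensor" where
  "pure_tensor K V W v w =
     tensor_null K V W +>\<^bsub>free_vs K (carrier V \<times> carrier W)\<^esub>
       free_gen K (carrier V \<times> carrier W) (v, w)"

text \<open>The linear map on the tensor product induced by a bilinear map \<open>\<beta>\<close> with values in \<open>X\<close>. The
  predicate \<^const>\<open>linear_map\<close> constrains a function on the carrier only, so uniqueness needs a fixed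
  value off the carrier.\<close>

definition tensor_lift ::
  "('a, 'm) ring_scheme \<Rightarrow> ('a, 'v, 'n) module_scheme \<Rightarrow> ('a, 'w, 'p) module_scheme
    \<Rightarrow> ('a, 'x, 'q) module_scheme \<Rightarrow> ('v \<Rightarrow> 'w \<Rightarrow> 'x) \<Rightarrow> ('a, 'v, 'w) tensor \<Rightarrow> 'x" where
  "tensor_lift K V W X \<beta> =
     (THE T. linear_map K (V \<boxtimes>\<^bsub>K\<^esub> W) X T \<and> T \<in> extensional (carrier (V \<boxtimes>\<^bsub>K\<^esub> W)) \<and>
       (\<forall>v\<in>carrier V. \<forall>w\<in>carrier W. T (pure_tensor K V W v w) = \<beta> v w))"

text \<open>\<open>tensor_map K V W V' W' f g\<close> is the tensor product of \<open>f : V \<rightarrow> V'\<close> and \<open>g : W \<rightarrow> W'\<close>.\<close>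

definition tensor_map ::
  "('a, 'm) ring_scheme \<Rightarrow> ('a, 'v, 'n) module_scheme \<Rightarrow> ('a, 'w, 'p) module_scheme
    \<Rightarrow> ('a, 'v2, 'q) module_scheme \<Rightarrow> ('a, 'w2, 'r) module_scheme
    \<Rightarrow> ('v \<Rightarrow> 'v2) \<Rightarrow> ('w \<Rightarrow> 'w2) \<Rightarrow> ('a, 'v, 'w) tensor \<Rightarrow> ('a, 'v2, 'w2) tensor" where
  "tensor_map K V W V' W' f g =
     tensor_lift K V W (V' \<boxtimes>\<^bsub>K\<^esub> W') (\<lambda>v w. pure_tensor K V' W' (f v) (g w))"

section \<open>Structural isomorphisms\<close>

text \<open>The associator from \<open>(U \<otimes> V) \<otimes> W\<close> to \<open>U \<otimes> (V \<otimes> W)\<close> and its inverse.\<close>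

definition assoc ::
  "('a, 'm) ring_scheme \<Rightarrow> ('a, 'u, 'n) module_scheme \<Rightarrow> ('a, 'v, 'p) module_scheme
    \<Rightarrow> ('a, 'w, 'q) module_scheme
    \<Rightarrow> ('a, ('a, 'u, 'v) tensor, 'w) tensor \<Rightarrow> ('a, 'u, ('a, 'v, 'w) tensor) tensor" where
  "assoc K U V W =
     tensor_lift K (U \<boxtimes>\<^bsub>K\<^esub> V) W (U \<boxtimes>\<^bsub>K\<^esub> (V \<boxtimes>\<^bsub>K\<^esub> W))
       (\<lambda>t w. tensor_lift K U V (U \<boxtimes>\<^bsub>K\<^esub> (V \<boxtimes>\<^bsub>K\<^esub> W))
         (\<lambda>u v. pure_tensor K U (V \<boxtimes>\<^bsub>K\<^esub> W) u (pure_tensor K V W v w)) t)"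

definition assoc_inv ::
  "('a, 'm) ring_scheme \<Rightarrow> ('a, 'u, 'n) module_scheme \<Rightarrow> ('a, 'v, 'p) module_scheme
    \<Rightarrow> ('a, 'w, 'q) module_scheme
    \<Rightarrow> ('a, 'u, ('a, 'v, 'w) tensor) tensor \<Rightarrow> ('a, ('a, 'u, 'v) tensor, 'w) tensor" where
  "assoc_inv K U V W =
     tensor_lift K U (V \<boxtimes>\<^bsub>K\<^esub> W) (U \<boxtimes>\<^bsub>K\<^esub> V \<boxtimes>\<^bsub>K\<^esub> W)
       (\<lambda>u t. tensor_lift K V W (U \<boxtimes>\<^bsub>K\<^esub> V \<boxtimes>\<^bsub>K\<^esub> W)
         (\<lambda>v w. pure_tensor K (U \<boxtimes>\<^bsub>K\<^esub> V) W (pure_tensor K U V u v) w) t)"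

text \<open>The rebracketing from \<open>(U \<otimes> V) \<otimes> (W \<otimes> X)\<close> to \<open>U \<otimes> ((V \<otimes> W) \<otimes> X)\<close> and its inverse.\<close>

definition join_mid ::
  "('a, 'm) ring_scheme \<Rightarrow> ('a, 'u, 'n) module_scheme \<Rightarrow> ('a, 'v, 'p) module_scheme
    \<Rightarrow> ('a, 'w, 'q) module_scheme \<Rightarrow> ('a, 'x, 'r) module_scheme
    \<Rightarrow> ('a, ('a, 'u, 'v) tensor, ('a, 'w, 'x) tensor) tensor
    \<Rightarrow> ('a, 'u, ('a, ('a, 'v, 'w) tensor, 'x) tensor) tensor" where
  "join_mid K U V W X =
     tensor_map K U (V \<boxtimes>\<^bsub>K\<^esub> (W \<boxtimes>\<^bsub>K\<^esub> X)) U (V \<boxtimes>\<^bsub>K\<^esub> W \<boxtimes>\<^bsub>K\<^esub> X) id (assoc_inv K V W X)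
     \<circ> assoc K U V (W \<boxtimes>\<^bsub>K\<^esub> X)"

definition split_mid ::
  "('a, 'm) ring_scheme \<Rightarrow> ('a, 'u, 'n) module_scheme \<Rightarrow> ('a, 'v, 'p) module_scheme
    \<Rightarrow> ('a, 'w, 'q) module_scheme \<Rightarrow> ('a, 'x, 'r) module_scheme
    \<Rightarrow> ('a, 'u, ('a, ('a, 'v, 'w) tensor, 'x) tensor) tensor
    \<Rightarrow> ('a, ('a, 'u, 'v) tensor, ('a, 'w, 'x) tensor) tensor" where
  "split_mid K U V W X =
     assoc_inv K U V (W \<boxtimes>\<^bsub>K\<^esub> X)
     \<circ> tensor_map K U (V \<boxtimes>\<^bsub>K\<^esub> W \<boxtimes>\<^bsub>K\<^esub> X) U (V \<boxtimes>\<^bsub>K\<^esub> (W \<boxtimes>\<^bsub>K\<^esub> X)) id (assoc K V W X)"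

text \<open>The isomorphisms of \<open>K \<otimes> V\<close> and of \<open>V \<otimes> K\<close> with \<open>V\<close>.\<close>

definition lunit ::
  "('a, 'm) ring_scheme \<Rightarrow> ('a, 'v, 'n) module_scheme \<Rightarrow> ('a, 'a, 'v) tensor \<Rightarrow> 'v" where
  "lunit K V = tensor_lift K (ground_vs K) V V (\<lambda>a v. a \<odot>\<^bsub>V\<^esub> v)"

definition runit ::
  "('a, 'm) ring_scheme \<Rightarrow> ('a, 'v, 'n) module_scheme \<Rightarrow> ('a, 'v, 'a) tensor \<Rightarrow> 'v" where
  "runit K V = tensor_lift K V (ground_vs K) V (\<lambda>v a. a \<odot>\<^bsub>V\<^esub> v)"

section \<open>Coalgebras\<close>

record ('a, 'c) coalgebra = "('a, 'c) module" +
  comult :: "'c \<Rightarrow> ('a, 'c, 'c) tensor" (\<open>\<Delta>\<index>\<close>)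
  counit :: "'c \<Rightarrow> 'a" (\<open>\<epsilon>\<index>\<close>)

locale coalgebra = vectorspace K C
  for K :: "('a, 'm) ring_scheme" and C :: "('a, 'c, 'n) coalgebra_scheme" +
  assumes comult_linear: "linear_map K C (C \<boxtimes>\<^bsub>K\<^esub> C) \<Delta>\<^bsub>C\<^esub>"
    and counit_linear: "linear_map K C (ground_vs K) \<epsilon>\<^bsub>C\<^esub>"
    and coassociative: "c \<in> carrier C \<Longrightarrow>
      assoc K C C C (tensor_map K C C (C \<boxtimes>\<^bsub>K\<^esub> C) C \<Delta>\<^bsub>C\<^esub> id (\<Delta>\<^bsub>C\<^esub> c))
        = tensor_map K C C C (C \<boxtimes>\<^bsub>K\<^esub> C) id \<Delta>\<^bsub>C\<^esub> (\<Delta>\<^bsub>C\<^esub> c)"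
    and counital_left: "c \<in> carrier C \<Longrightarrow>
      lunit K C (tensor_map K C C (ground_vs K) C \<epsilon>\<^bsub>C\<^esub> id (\<Delta>\<^bsub>C\<^esub> c)) = c"
    and counital_right: "c \<in> carrier C \<Longrightarrow>
      runit K C (tensor_map K C C C (ground_vs K) id \<epsilon>\<^bsub>C\<^esub> (\<Delta>\<^bsub>C\<^esub> c)) = c"

section \<open>Twist maps\<close>

text \<open>Compositions below are read from bottom to top; rebracketings are inserted where the
  mathematical formula suppresses them.\<close>

definition twisted_comult ::
  "('a, 'm) ring_scheme \<Rightarrow> ('a, 'c, 'n) coalgebra_scheme \<Rightarrow> ('a, 'd, 'p) coalgebra_scheme
    \<Rightarrow> (('a, 'c, 'd) tensor \<Rightarrow> ('a, 'd, 'c) tensor)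
    \<Rightarrow> ('a, 'c, 'd) tensor \<Rightarrow> ('a, ('a, 'c, 'd) tensor, ('a, 'c, 'd) tensor) tensor" where
  "twisted_comult K C D \<Psi> =
     split_mid K C D C D
     \<circ> tensor_map K C (C \<boxtimes>\<^bsub>K\<^esub> D \<boxtimes>\<^bsub>K\<^esub> D) C (D \<boxtimes>\<^bsub>K\<^esub> C \<boxtimes>\<^bsub>K\<^esub> D) id
         (tensor_map K (C \<boxtimes>\<^bsub>K\<^esub> D) D (D \<boxtimes>\<^bsub>K\<^esub> C) D \<Psi> id)
     \<circ> join_mid K C C D D
     \<circ> tensor_map K C D (C \<boxtimes>\<^bsub>K\<^esub> C) (D \<boxtimes>\<^bsub>K\<^esub> D) \<Delta>\<^bsub>C\<^esub> \<Delta>\<^bsub>D\<^esub>"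

definition twist_coassociative ::
  "('a, 'm) ring_scheme \<Rightarrow> ('a, 'c, 'n) coalgebra_scheme \<Rightarrow> ('a, 'd, 'p) coalgebra_scheme
    \<Rightarrow> (('a, 'c, 'd) tensor \<Rightarrow> ('a, 'd, 'c) tensor) \<Rightarrow> bool" where
  "twist_coassociative K C D \<Psi> \<longleftrightarrow> (\<forall>t \<in> carrier (C \<boxtimes>\<^bsub>K\<^esub> D).
     (tensor_map K (D \<boxtimes>\<^bsub>K\<^esub> C) (C \<boxtimes>\<^bsub>K\<^esub> D) (D \<boxtimes>\<^bsub>K\<^esub> C) (D \<boxtimes>\<^bsub>K\<^esub> C) id \<Psi>
      \<circ> split_mid K D C C D
      \<circ> tensor_map K D (C \<boxtimes>\<^bsub>K\<^esub> D) D (C \<boxtimes>\<^bsub>K\<^esub> C \<boxtimes>\<^bsub>K\<^esub> D) id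
          (tensor_map K C D (C \<boxtimes>\<^bsub>K\<^esub> C) D \<Delta>\<^bsub>C\<^esub> id)
      \<circ> assoc K D C D
      \<circ> tensor_map K (C \<boxtimes>\<^bsub>K\<^esub> D) D (D \<boxtimes>\<^bsub>K\<^esub> C) D \<Psi> id
      \<circ> assoc_inv K C D D
      \<circ> tensor_map K C D C (D \<boxtimes>\<^bsub>K\<^esub> D) id \<Delta>\<^bsub>D\<^esub>) t =
     (tensor_map K (C \<boxtimes>\<^bsub>K\<^esub> D) (D \<boxtimes>\<^bsub>K\<^esub> C) (D \<boxtimes>\<^bsub>K\<^esub> C) (D \<boxtimes>\<^bsub>K\<^esub> C) \<Psi> id
      \<circ> split_mid K C D D C
      \<circ> tensor_map K C (D \<boxtimes>\<^bsub>K\<^esub> C) C (D \<boxtimes>\<^bsub>K\<^esub> D \<boxtimes>\<^bsub>K\<^esub> C) id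
          (tensor_map K D C (D \<boxtimes>\<^bsub>K\<^esub> D) C \<Delta>\<^bsub>D\<^esub> id)
      \<circ> tensor_map K C (C \<boxtimes>\<^bsub>K\<^esub> D) C (D \<boxtimes>\<^bsub>K\<^esub> C) id \<Psi>
      \<circ> assoc K C C D
      \<circ> tensor_map K C D (C \<boxtimes>\<^bsub>K\<^esub> C) D \<Delta>\<^bsub>C\<^esub> id) t)"

text \<open>The map \<open>\<epsilon>\<^sub>D \<otimes> \<epsilon>\<^sub>C\<close>, with \<open>K \<otimes> K\<close> identified with \<open>K\<close>.\<close>

definition counit_tensor ::
  "('a, 'm) ring_scheme \<Rightarrow> ('a, 'd, 'p) coalgebra_scheme \<Rightarrow> ('a, 'c, 'n) coalgebra_scheme
    \<Rightarrow> ('a, 'd, 'c) tensor \<Rightarrow> 'a" where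
  "counit_tensor K D C =
     lunit K (ground_vs K) \<circ> tensor_map K D C (ground_vs K) (ground_vs K) \<epsilon>\<^bsub>D\<^esub> \<epsilon>\<^bsub>C\<^esub>"

definition right_conormal ::
  "('a, 'm) ring_scheme \<Rightarrow> ('a, 'c, 'n) coalgebra_scheme \<Rightarrow> ('a, 'd, 'p) coalgebra_scheme
    \<Rightarrow> (('a, 'c, 'd) tensor \<Rightarrow> ('a, 'd, 'c) tensor)
    \<Rightarrow> (('a, 'c, 'd) tensor \<Rightarrow> ('a, 'd, 'c) tensor) \<Rightarrow> bool" where
  "right_conormal K C D Z \<Psi> \<longleftrightarrow> (\<forall>t \<in> carrier (C \<boxtimes>\<^bsub>K\<^esub> D).
     (lunit K C
      \<circ> tensor_map K (D \<boxtimes>\<^bsub>K\<^esub> C) C (ground_vs K) C (counit_tensor K D C) id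
      \<circ> tensor_map K (C \<boxtimes>\<^bsub>K\<^esub> D) C (D \<boxtimes>\<^bsub>K\<^esub> C) C Z id
      \<circ> assoc_inv K C D C
      \<circ> tensor_map K C (C \<boxtimes>\<^bsub>K\<^esub> D) C (D \<boxtimes>\<^bsub>K\<^esub> C) id \<Psi>
      \<circ> assoc K C C D
      \<circ> tensor_map K C D (C \<boxtimes>\<^bsub>K\<^esub> C) D \<Delta>\<^bsub>C\<^esub> id) t =
     (runit K C \<circ> tensor_map K C D C (ground_vs K) id \<epsilon>\<^bsub>D\<^esub>) t)"

definition left_conormal ::
  "('a, 'm) ring_scheme \<Rightarrow> ('a, 'c, 'n) coalgebra_scheme \<Rightarrow> ('a, 'd, 'p) coalgebra_scheme
    \<Rightarrow> (('a, 'c, 'd) tensor \<Rightarrow> ('a, 'd, 'c) tensor)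
    \<Rightarrow> (('a, 'c, 'd) tensor \<Rightarrow> ('a, 'd, 'c) tensor) \<Rightarrow> bool" where
  "left_conormal K C D Z \<Psi> \<longleftrightarrow> (\<forall>t \<in> carrier (C \<boxtimes>\<^bsub>K\<^esub> D).
     (runit K D
      \<circ> tensor_map K D (D \<boxtimes>\<^bsub>K\<^esub> C) D (ground_vs K) id (counit_tensor K D C)
      \<circ> tensor_map K D (C \<boxtimes>\<^bsub>K\<^esub> D) D (D \<boxtimes>\<^bsub>K\<^esub> C) id Z
      \<circ> assoc K D C D
      \<circ> tensor_map K (C \<boxtimes>\<^bsub>K\<^esub> D) D (D \<boxtimes>\<^bsub>K\<^esub> C) D \<Psi> id
      \<circ> assoc_inv K C D D
      \<circ> tensor_map K C D C (D \<boxtimes>\<^bsub>K\<^esub> D) id \<Delta>\<^bsub>D\<^esub>) t =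
     (lunit K D \<circ> tensor_map K C D (ground_vs K) D \<epsilon>\<^bsub>C\<^esub> id) t)"

definition conormal ::
  "('a, 'm) ring_scheme \<Rightarrow> ('a, 'c, 'n) coalgebra_scheme \<Rightarrow> ('a, 'd, 'p) coalgebra_scheme
    \<Rightarrow> (('a, 'c, 'd) tensor \<Rightarrow> ('a, 'd, 'c) tensor)
    \<Rightarrow> (('a, 'c, 'd) tensor \<Rightarrow> ('a, 'd, 'c) tensor) \<Rightarrow> bool" where
  "conormal K C D Z \<Psi> \<longleftrightarrow> right_conormal K C D Z \<Psi> \<and> left_conormal K C D Z \<Psi>"

definition is_counit_for ::
  "('a, 'm) ring_scheme \<Rightarrow> ('a, 'v, 'n) module_scheme \<Rightarrow> ('v \<Rightarrow> ('a, 'v, 'v) tensor)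
    \<Rightarrow> ('v \<Rightarrow> 'a) \<Rightarrow> bool" where
  "is_counit_for K V \<delta> e \<longleftrightarrow> (\<forall>v \<in> carrier V.
     lunit K V (tensor_map K V V (ground_vs K) V e id (\<delta> v)) = v \<and>
     runit K V (tensor_map K V V V (ground_vs K) id e (\<delta> v)) = v)"

end

theory Submission
  imports Defs
begin

text \<open>
  Write \<open>e = \<epsilon>\<^sub>Z\<close>. In Sweedler notation the twisted coproduct sends \<open>c \<otimes> d\<close> to
  \<open>c\<^sub>1 \<otimes> d\<^sub>1\<^sup>\<Psi> \<otimes> c\<^sub>2\<^sup>\<Psi> \<otimes> d\<^sub>2\<close>. Applying \<open>e\<close> to the left half involves \<open>d\<^sub>2\<close> only as a spectator:
  with the map \<open>R : C \<otimes> D \<rightarrow> C\<close>, \<open>R (c \<otimes> d) = e (c\<^sub>1 \<otimes> d\<^sup>\<Psi>) c\<^sub>2\<^sup>\<Psi>\<close>, one has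
  \<open>(e \<otimes> id) \<Delta>\<^sub>\<Psi> = (R \<otimes> id) (id \<otimes> \<Delta>\<^sub>D)\<close> (lemma \<open>twist_mid_contract_left\<close>). The right-hand side is the
  endomorphism of the cofree right \<open>D\<close>-comodule \<open>C \<otimes> D\<close> induced by \<open>R\<close>. Such endomorphisms correspond
  bijectively to linear maps \<open>C \<otimes> D \<rightarrow> C\<close>, and the identity corresponds to \<open>id \<otimes> \<epsilon>\<^sub>D\<close> (lemma
  \<open>cofree_right_identity_iff\<close>). So the left counit law for \<open>e\<close> says \<open>R = id \<otimes> \<epsilon>\<^sub>D\<close>, which is right
  conormality. In the same way the right counit law is equivalent to left conormality, through
  \<open>L (c \<otimes> d) = e (c\<^sup>\<Psi> \<otimes> d\<^sub>2) d\<^sub>1\<^sup>\<Psi>\<close> and the cofree left \<open>C\<close>-comodule \<open>C \<otimes> D\<close> (lemmas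
  \<open>twist_mid_contract_right\<close> and \<open>cofree_left_identity_iff\<close>).

  Sweedler notation has to be justified for tensor products constructed as quotients of free
  spaces. This rests on two facts: bilinear maps lift to linear maps (\<open>tensor_lift\<close>), and linear maps
  that agree on pure tensors are equal (\<open>tensor_eqI\<close>). They give the values of all structural maps on
  pure tensors, and each identity then reduces to a computation with such values.
\<close>

section \<open>Linear maps\<close>

lemma linear_mapI:
  assumes "vectorspace K V" "vectorspace K W"
    and "\<And>x. x \<in> carrier V \<Longrightarrow> f x \<in> carrier W"
    and "\<And>x y. x \<in> carrier V \<Longrightarrow> y \<in> carrier V \<Longrightarrow> f (x \<oplus>\<^bsub>V\<^esub> y) = f x \<oplus>\<^bsub>W\<^esub> f y"
    and "\<And>a x. a \<in> carrier K \<Longrightarrow> x \<in> carrier V \<Longrightarrow> f (a \<odot>\<^bsub>V\<^esub> x) = a \<odot>\<^bsub>W\<^esub> f x"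
  shows "linear_map K V W f"
  using assms
  by (auto simp: linear_map_def mod_hom_def mod_hom_axioms_def module_hom_def vectorspace_def)

lemma linear_mapD:
  assumes "linear_map K V W f"
  shows linear_map_dom: "vectorspace K V" and linear_map_cod: "vectorspace K W"
    and linear_map_closed: "x \<in> carrier V \<Longrightarrow> f x \<in> carrier W"
    and linear_map_add: "x \<in> carrier V \<Longrightarrow> y \<in> carrier V \<Longrightarrow> f (x \<oplus>\<^bsub>V\<^esub> y) = f x \<oplus>\<^bsub>W\<^esub> f y"
    and linear_map_smult: "a \<in> carrier K \<Longrightarrow> x \<in> carrier V \<Longrightarrow> f (a \<odot>\<^bsub>V\<^esub> x) = a \<odot>\<^bsub>W\<^esub> f x"
  using assms
  by (auto simp: linear_map_def mod_hom_def mod_hom_axioms_def module_hom_def)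

lemma linear_map_id: "vectorspace K V \<Longrightarrow> linear_map K V V id"
  by (rule linear_mapI) auto

text \<open>The form in which the identity appears once the simplifier has unfolded an eta-expanded \<open>id\<close>.\<close>

lemma linear_map_ident [simp]: "vectorspace K V \<Longrightarrow> linear_map K V V (\<lambda>x. x)"
  using linear_map_id[of K V] by (simp add: id_def)

lemma linear_map_comp:
  "linear_map K V W g \<Longrightarrow> linear_map K U V f \<Longrightarrow> linear_map K U W (g \<circ> f)"
  by (rule linear_mapI) (auto simp: linear_map_dom linear_map_cod linear_map_closed
      linear_map_add linear_map_smult)

lemma linear_map_cong:
  assumes "linear_map K V W f" "\<And>x. x \<in> carrier V \<Longrightarrow> g x = f x"
  shows "linear_map K V W g"
proof -
  interpret linear_map K V W f by (rule assms)
  show ?thesis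
    by (rule linear_mapI) (auto simp: assms(2) V.vectorspace_axioms W.vectorspace_axioms)
qed

lemma ground_vs_sel [simp]:
  "carrier (ground_vs K) = carrier K" "add (ground_vs K) = add K"
  "module.smult (ground_vs K) = mult K" "zero (ground_vs K) = zero K"
  by (simp_all add: ground_vs_def)

lemma vectorspace_ground:
  assumes "field K" shows "vectorspace K (ground_vs K)"
proof -
  interpret field K by (rule assms)
  show ?thesis
    by (rule vs_criteria) (auto simp: assms a_ac m_ac l_distr r_distr intro: r_neg)
qed

section \<open>Free vector spaces\<close>

lemma free_vs_sel [simp]:
  "zero (free_vs K S) = (\<lambda>s\<in>S. \<zero>\<^bsub>K\<^esub>)"
  "add (free_vs K S) f g = (\<lambda>s\<in>S. f s \<oplus>\<^bsub>K\<^esub> g s)" 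
  "a \<odot>\<^bsub>free_vs K S\<^esub> f = (\<lambda>s\<in>S. a \<otimes>\<^bsub>K\<^esub> f s)"
  if "ring K"
  using that by (simp_all add: free_vs_def ring.func_space_def)

lemma carrier_free_vs:
  "ring K \<Longrightarrow> carrier (free_vs K S) = {f \<in> S \<rightarrow>\<^sub>E carrier K. finite {x \<in> S. f x \<noteq> \<zero>\<^bsub>K\<^esub>}}"
  by (simp add: free_vs_def)

lemma vectorspace_free_vs:
  assumes "field K" shows "vectorspace K (free_vs K S)"
proof -
  interpret field K by (rule assms)
  interpret F: module K "func_space S" by (rule func_space_is_module)
  have "submodule K {f \<in> S \<rightarrow>\<^sub>E carrier K. finite {x \<in> S. f x \<noteq> \<zero>\<^bsub>K\<^esub>}} (func_space S)"
  proof (unfold_locales, goal_cases)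
    case (2 f g)
    have "{s \<in> S. f s \<oplus>\<^bsub>K\<^esub> g s \<noteq> \<zero>\<^bsub>K\<^esub>} \<subseteq> {s \<in> S. f s \<noteq> \<zero>\<^bsub>K\<^esub>} \<union> {s \<in> S. g s \<noteq> \<zero>\<^bsub>K\<^esub>}"
      using 2 by auto
    with 2 show ?case by (auto simp: func_space_def PiE_mem intro: finite_subset cong: conj_cong)
  next
    case (4 c f)
    have "{s \<in> S. c \<otimes>\<^bsub>K\<^esub> f s \<noteq> \<zero>\<^bsub>K\<^esub>} \<subseteq> {s \<in> S. f s \<noteq> \<zero>\<^bsub>K\<^esub>}" using 4 by auto
    with 4 show ?case by (auto simp: func_space_def PiE_mem intro: finite_subset cong: conj_cong)
  qed (auto simp: func_space_def cong: conj_cong)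
  then have "module K (free_vs K S)"
    unfolding free_vs_def by (rule F.submodule_is_module)
  then show ?thesis by (simp add: vectorspace_def assms)
qed

lemma free_gen_closed:
  assumes "ring K" "s \<in> S" shows "free_gen K S s \<in> carrier (free_vs K S)"
proof -
  interpret ring K by fact
  have "{x \<in> S. free_gen K S s x \<noteq> \<zero>\<^bsub>K\<^esub>} \<subseteq> {s}" by (auto simp: free_gen_def)
  with assms show ?thesis
    by (auto simp: carrier_free_vs intro: finite_subset) (auto simp: free_gen_def)
qed

text \<open>A finitely supported function is built from \<open>0\<close> by adding multiples of generators, one for each
  point of its support; a property closed under this step therefore holds on the whole free space.\<close>

lemma free_vs_induct [consumes 2, case_names zero add]:
  assumes "field K" and f: "f \<in> carrier (free_vs K S)"
    and zero: "P \<zero>\<^bsub>free_vs K S\<^esub>"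
    and add: "\<And>a s f. a \<in> carrier K \<Longrightarrow> s \<in> S \<Longrightarrow> f \<in> carrier (free_vs K S) \<Longrightarrow> P f \<Longrightarrow>
      P (a \<odot>\<^bsub>free_vs K S\<^esub> free_gen K S s \<oplus>\<^bsub>free_vs K S\<^esub> f)"
  shows "P f"
proof -
  interpret field K by fact
  have "finite A \<Longrightarrow> A \<subseteq> S \<Longrightarrow> f \<in> carrier (free_vs K S) \<Longrightarrow> {s \<in> S. f s \<noteq> \<zero>\<^bsub>K\<^esub>} = A \<Longrightarrow> P f" for A f
  proof (induction A arbitrary: f rule: finite_induct)
    case empty
    then have "f = \<zero>\<^bsub>free_vs K S\<^esub>"
      by (auto simp: ring_axioms carrier_free_vs PiE_def extensional_def)
    with zero show ?case by simp
  next
    case (insert s A)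
    let ?g = "f(s := \<zero>\<^bsub>K\<^esub>)"
    have supp: "{x \<in> S. ?g x \<noteq> \<zero>\<^bsub>K\<^esub>} = A" using insert by auto
    have s: "s \<in> S" and fs: "f s \<in> carrier K"
      using insert by (auto simp: ring_axioms carrier_free_vs)
    have g: "?g \<in> carrier (free_vs K S)"
      using insert.prems(2) insert.hyps(1) s unfolding carrier_free_vs[OF ring_axioms] mem_Collect_eq supp
      by (auto simp: PiE_def extensional_def Pi_def)
    have "f = f s \<odot>\<^bsub>free_vs K S\<^esub> free_gen K S s \<oplus>\<^bsub>free_vs K S\<^esub> ?g"
      using insert.prems fs s
      by (auto simp: ring_axioms carrier_free_vs free_gen_def fun_eq_iff PiE_def extensional_def Pi_def)
    then show ?case using add[OF fs s g insert.IH[OF _ g supp]] insert.prems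
      by (simp del: fun_upd_apply)
  qed
  with f show ?thesis by (auto simp: ring_axioms carrier_free_vs)
qed

definition free_extend ::
  "('a, 'm) ring_scheme \<Rightarrow> 's set \<Rightarrow> ('a, 'x, 'q) module_scheme \<Rightarrow> ('s \<Rightarrow> 'x) \<Rightarrow> ('s \<Rightarrow> 'a) \<Rightarrow> 'x" where
  "free_extend K S X h f = (\<Oplus>\<^bsub>X\<^esub>s\<in>{s \<in> S. f s \<noteq> \<zero>\<^bsub>K\<^esub>}. f s \<odot>\<^bsub>X\<^esub> h s)"

text \<open>The support of a sum may be smaller than the union of the supports, so additivity of the extension
  needs its value as a sum over a common larger set.\<close>

lemma free_extend_supset:
  assumes "vectorspace K X" "h \<in> S \<rightarrow> carrier X" "f \<in> S \<rightarrow> carrier K"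
    and "finite A" "A \<subseteq> S" "{s \<in> S. f s \<noteq> \<zero>\<^bsub>K\<^esub>} \<subseteq> A"
  shows "free_extend K S X h f = (\<Oplus>\<^bsub>X\<^esub>s\<in>A. f s \<odot>\<^bsub>X\<^esub> h s)"
proof -
  interpret X: vectorspace K X by fact
  show ?thesis unfolding free_extend_def
    by (rule X.add.finprod_mono_neutral_cong_left) (use assms in \<open>auto simp: Pi_def\<close>)
qed

lemma linear_map_free_extend:
  assumes X: "vectorspace K X" and h: "h \<in> S \<rightarrow> carrier X"
  shows "linear_map K (free_vs K S) X (free_extend K S X h)"
proof -
  interpret X: vectorspace K X by fact
  note [simp] = X.R.ring_axioms
  note F = vectorspace_free_vs[OF X.field_axioms, of S]
  interpret F: vectorspace K "free_vs K S" by (rule F)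
  show ?thesis
  proof (rule linear_mapI[OF F X])
    fix f assume "f \<in> carrier (free_vs K S)"
    then show "free_extend K S X h f \<in> carrier X"
      using h by (auto simp: carrier_free_vs free_extend_def Pi_def PiE_def intro!: X.M.finsum_closed)
  next
    fix f g assume fg: "f \<in> carrier (free_vs K S)" "g \<in> carrier (free_vs K S)"
    let ?A = "{s \<in> S. f s \<noteq> \<zero>\<^bsub>K\<^esub>} \<union> {s \<in> S. g s \<noteq> \<zero>\<^bsub>K\<^esub>}"
    have fin: "finite ?A" using fg by (auto simp: carrier_free_vs)
    have K: "f \<in> S \<rightarrow> carrier K" "g \<in> S \<rightarrow> carrier K"
      using fg by (auto simp: carrier_free_vs PiE_def)
    have sum: "f \<oplus>\<^bsub>free_vs K S\<^esub> g \<in> S \<rightarrow> carrier K" using K by (auto simp: Pi_def)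
    have eq: "free_extend K S X h k = (\<Oplus>\<^bsub>X\<^esub>s\<in>?A. k s \<odot>\<^bsub>X\<^esub> h s)"
      if "k \<in> {f, g, f \<oplus>\<^bsub>free_vs K S\<^esub> g}" for k
      by (rule free_extend_supset[OF X h _ fin]) (use that K sum in \<open>auto simp: Pi_def\<close>)
    have "(\<Oplus>\<^bsub>X\<^esub>s\<in>?A. (f \<oplus>\<^bsub>free_vs K S\<^esub> g) s \<odot>\<^bsub>X\<^esub> h s)
        = (\<Oplus>\<^bsub>X\<^esub>s\<in>?A. f s \<odot>\<^bsub>X\<^esub> h s \<oplus>\<^bsub>X\<^esub> g s \<odot>\<^bsub>X\<^esub> h s)"
      by (rule X.M.finsum_cong') (use K h in \<open>auto simp: Pi_def X.smult_l_distr\<close>)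
    also have "\<dots> = (\<Oplus>\<^bsub>X\<^esub>s\<in>?A. f s \<odot>\<^bsub>X\<^esub> h s) \<oplus>\<^bsub>X\<^esub> (\<Oplus>\<^bsub>X\<^esub>s\<in>?A. g s \<odot>\<^bsub>X\<^esub> h s)"
      by (rule X.M.finsum_addf) (use K h in \<open>auto simp: Pi_def\<close>)
    finally show "free_extend K S X h (f \<oplus>\<^bsub>free_vs K S\<^esub> g) = free_extend K S X h f \<oplus>\<^bsub>X\<^esub> free_extend K S X h g"
      by (simp only: eq insert_iff simp_thms)
  next
    fix a f assume a: "a \<in> carrier K" and f: "f \<in> carrier (free_vs K S)"
    let ?A = "{s \<in> S. f s \<noteq> \<zero>\<^bsub>K\<^esub>}"
    have fin: "finite ?A" using f by (auto simp: carrier_free_vs)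
    have K: "f \<in> S \<rightarrow> carrier K"
      using f by (auto simp: carrier_free_vs PiE_def)
    have "free_extend K S X h (a \<odot>\<^bsub>free_vs K S\<^esub> f)
        = (\<Oplus>\<^bsub>X\<^esub>s\<in>?A. (a \<odot>\<^bsub>free_vs K S\<^esub> f) s \<odot>\<^bsub>X\<^esub> h s)"
      by (rule free_extend_supset[OF X h _ fin]) (use K a in \<open>auto simp: Pi_def\<close>)
    also have "\<dots> = (\<Oplus>\<^bsub>X\<^esub>s\<in>?A. a \<odot>\<^bsub>X\<^esub> (f s \<odot>\<^bsub>X\<^esub> h s))"
      by (rule X.M.finsum_cong') (use K h a in \<open>auto simp: Pi_def X.smult_assoc1\<close>)
    also have "\<dots> = a \<odot>\<^bsub>X\<^esub> (\<Oplus>\<^bsub>X\<^esub>s\<in>?A. f s \<odot>\<^bsub>X\<^esub> h s)"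
      by (rule X.finsum_smult[symmetric]) (use K h a fin in \<open>auto simp: Pi_def\<close>)
    finally show "free_extend K S X h (a \<odot>\<^bsub>free_vs K S\<^esub> f) = a \<odot>\<^bsub>X\<^esub> free_extend K S X h f"
      by (simp add: free_extend_def)
  qed
qed

lemma free_extend_gen:
  assumes X: "vectorspace K X" and h: "h \<in> S \<rightarrow> carrier X" and s: "s \<in> S"
  shows "free_extend K S X h (free_gen K S s) = h s"
proof -
  interpret X: vectorspace K X by fact
  have "{x \<in> S. free_gen K S s x \<noteq> \<zero>\<^bsub>K\<^esub>} = {s}" using s by (auto simp: free_gen_def)
  moreover have "free_gen K S s s = \<one>\<^bsub>K\<^esub>" using s by (simp add: free_gen_def)
  moreover have "h s \<in> carrier X" using h s by auto
  ultimately show ?thesis by (simp add: free_extend_def)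
qed

section \<open>Quotient spaces\<close>

lemma submodule_imp_abelian_subgroup:
  assumes "submodule K N V" shows "abelian_subgroup N V"
proof -
  interpret N: submodule K N V by fact
  interpret module K V by (rule N.module)
  have "subgroup N (add_monoid V)"
  proof (rule add.subgroupI)
    show "\<ominus>\<^bsub>V\<^esub> a \<in> N" if "a \<in> N" for a
    proof -
      have "(\<ominus>\<^bsub>K\<^esub> \<one>\<^bsub>K\<^esub>) \<odot>\<^bsub>V\<^esub> a \<in> N" using that by (intro N.smult_closed) auto
      then show ?thesis using that N.subset by (simp add: smult_minus_1 subsetD)
    qed
  qed (use N.subset N.zero_closed in \<open>auto simp del: N.zero_closed\<close>)
  then show ?thesis
    by (simp add: abelian_subgroupI3 additive_subgroupI abelian_group_axioms)
qed

lemma carrier_quotient: "carrier (quotient_vs V N) = (\<lambda>x. N +>\<^bsub>V\<^esub> x) ` carrier V"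
  by (auto simp: quotient_vs_def A_RCOSETS_def')

lemma quotient_add:
  assumes N: "submodule K N V" and "x \<in> carrier V" "y \<in> carrier V"
  shows "(N +>\<^bsub>V\<^esub> x) \<oplus>\<^bsub>quotient_vs V N\<^esub> (N +>\<^bsub>V\<^esub> y) = N +>\<^bsub>V\<^esub> (x \<oplus>\<^bsub>V\<^esub> y)"
  using assms
  by (simp add: quotient_vs_def abelian_subgroup.a_rcos_sum submodule_imp_abelian_subgroup)

lemma quotient_eqI:
  assumes N: "submodule K N V" and "x \<in> carrier V" "y \<in> carrier V" "x \<ominus>\<^bsub>V\<^esub> y \<in> N"
  shows "N +>\<^bsub>V\<^esub> x = N +>\<^bsub>V\<^esub> y"
proof -
  interpret abelian_subgroup N V by (rule submodule_imp_abelian_subgroup) (rule N)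
  have "x \<in> N +>\<^bsub>V\<^esub> y" using assms by (intro a_rcos_module_rev) (auto simp: a_minus_def)
  then show ?thesis using assms by (metis a_repr_independence')
qed

lemma quotient_eqD:
  assumes N: "submodule K N V" and "x \<in> carrier V" "y \<in> N +>\<^bsub>V\<^esub> x"
  shows "y \<in> carrier V" "y \<ominus>\<^bsub>V\<^esub> x \<in> N"
proof -
  interpret abelian_subgroup N V by (rule submodule_imp_abelian_subgroup) (rule N)
  show "y \<in> carrier V" using assms a_elemrcos_carrier by blast
  show "y \<ominus>\<^bsub>V\<^esub> x \<in> N" using assms a_rcos_module_imp by (auto simp: a_minus_def)
qed

text \<open>Multiplying all members of a coset \<open>N + x\<close> by \<open>a\<close> gives members of the one coset \<open>N + a x\<close>, so the
  union that defines the scalar product in the quotient is a union of copies of that coset.\<close>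

lemma quotient_smult:
  assumes N: "submodule K N V" and a: "a \<in> carrier K" and x: "x \<in> carrier V"
  shows "a \<odot>\<^bsub>quotient_vs V N\<^esub> (N +>\<^bsub>V\<^esub> x) = N +>\<^bsub>V\<^esub> (a \<odot>\<^bsub>V\<^esub> x)"
proof -
  interpret N: submodule K N V by fact
  interpret module K V by (rule N.module)
  interpret abelian_subgroup N V by (rule submodule_imp_abelian_subgroup) (rule N)
  have "N +>\<^bsub>V\<^esub> (a \<odot>\<^bsub>V\<^esub> y) = N +>\<^bsub>V\<^esub> (a \<odot>\<^bsub>V\<^esub> x)" if "y \<in> N +>\<^bsub>V\<^esub> x" for y
  proof (rule quotient_eqI[OF N])
    have y: "y \<in> carrier V" "y \<ominus>\<^bsub>V\<^esub> x \<in> N" using quotient_eqD[OF N x that] by auto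
    have "a \<odot>\<^bsub>V\<^esub> y \<ominus>\<^bsub>V\<^esub> a \<odot>\<^bsub>V\<^esub> x = a \<odot>\<^bsub>V\<^esub> (y \<ominus>\<^bsub>V\<^esub> x)"
      using y x a by (simp add: a_minus_def smult_r_distr smult_r_minus)
    then show "a \<odot>\<^bsub>V\<^esub> y \<ominus>\<^bsub>V\<^esub> a \<odot>\<^bsub>V\<^esub> x \<in> N" using y a by simp
    show "a \<odot>\<^bsub>V\<^esub> y \<in> carrier V" "a \<odot>\<^bsub>V\<^esub> x \<in> carrier V" using a x y by auto
  qed
  then have "(\<Union>y\<in>N +>\<^bsub>V\<^esub> x. N +>\<^bsub>V\<^esub> (a \<odot>\<^bsub>V\<^esub> y))
      = (\<Union>y\<in>N +>\<^bsub>V\<^esub> x. N +>\<^bsub>V\<^esub> (a \<odot>\<^bsub>V\<^esub> x))"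
    by (rule SUP_cong[OF refl])
  also have "\<dots> = N +>\<^bsub>V\<^esub> (a \<odot>\<^bsub>V\<^esub> x)" using a_rcos_self[OF x] by blast
  finally show ?thesis by (simp add: quotient_vs_def)
qed

lemma vectorspace_quotient:
  assumes V: "vectorspace K V" and N: "submodule K N V"
  shows "vectorspace K (quotient_vs V N)"
proof -
  interpret V: vectorspace K V by fact
  interpret N: abelian_subgroup N V by (rule submodule_imp_abelian_subgroup) (rule N)
  have zero: "\<zero>\<^bsub>quotient_vs V N\<^esub> = N +>\<^bsub>V\<^esub> \<zero>\<^bsub>V\<^esub>"
    by (simp add: quotient_vs_def N.a_subset)
  show ?thesis
  proof (rule vs_criteria, goal_cases)
    case 4
    show ?case unfolding carrier_quotient ball_simps bex_simps zero
    proof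
      fix v assume "v \<in> carrier V"
      then show "\<exists>w\<in>carrier V. (N +>\<^bsub>V\<^esub> v) \<oplus>\<^bsub>quotient_vs V N\<^esub> (N +>\<^bsub>V\<^esub> w) = N +>\<^bsub>V\<^esub> \<zero>\<^bsub>V\<^esub>"
        by (intro bexI[of _ "\<ominus>\<^bsub>V\<^esub> v"]) (auto simp: quotient_add[OF N] V.M.r_neg)
    qed
  qed (auto simp: carrier_quotient zero quotient_add[OF N] quotient_smult[OF N] V.field_axioms
      V.M.a_ac V.smult_l_distr V.smult_r_distr V.smult_assoc1)
qed

lemma linear_map_quotient_proj:
  assumes V: "vectorspace K V" and N: "submodule K N V"
  shows "linear_map K V (quotient_vs V N) (\<lambda>x. N +>\<^bsub>V\<^esub> x)"
  by (rule linear_mapI[OF V vectorspace_quotient[OF V N]])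
    (simp_all add: carrier_quotient quotient_add[OF N] quotient_smult[OF N])

text \<open>The factor evaluates \<open>f\<close> at a chosen member of each coset; two members differ by an element
  of \<open>N\<close>, on which \<open>f\<close> vanishes, so the choice does not matter.\<close>

lemma quotient_factor:
  assumes f: "linear_map K V X f" and N: "submodule K N V"
    and ker: "\<And>x. x \<in> N \<Longrightarrow> f x = \<zero>\<^bsub>X\<^esub>"
  obtains g where "linear_map K (quotient_vs V N) X g"
    and "\<And>x. x \<in> carrier V \<Longrightarrow> g (N +>\<^bsub>V\<^esub> x) = f x"
proof -
  interpret linear_map K V X f by (rule f)
  interpret N: abelian_subgroup N V by (rule submodule_imp_abelian_subgroup) (rule N)
  define g where "g Y = f (SOME y. y \<in> Y)" for Y
  have g: "g (N +>\<^bsub>V\<^esub> x) = f x" if x: "x \<in> carrier V" for x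
  proof -
    define y where "y = (SOME y. y \<in> N +>\<^bsub>V\<^esub> x)"
    have "y \<in> N +>\<^bsub>V\<^esub> x" unfolding y_def by (rule someI) (rule N.a_rcos_self[OF x])
    then have y: "y \<in> carrier V" "y \<ominus>\<^bsub>V\<^esub> x \<in> N" using quotient_eqD[OF N x] by auto
    have "f y \<ominus>\<^bsub>X\<^esub> f x = \<zero>\<^bsub>X\<^esub>" using ker[OF y(2)] x y by simp
    then have "f y = f x" using x y by simp
    then show ?thesis by (simp add: g_def y_def)
  qed
  have lin: "linear_map K (quotient_vs V N) X g"
    by (rule linear_mapI[OF vectorspace_quotient[OF V.vectorspace_axioms N] W.vectorspace_axioms])
      (auto simp: carrier_quotient g quotient_add[OF N] quotient_smult[OF N])
  show ?thesis by (rule that[OF lin g])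
qed

section \<open>The universal property of the tensor product\<close>

definition bilinear_map ::
  "('a, 'm) ring_scheme \<Rightarrow> ('a, 'v, 'n) module_scheme \<Rightarrow> ('a, 'w, 'p) module_scheme
    \<Rightarrow> ('a, 'x, 'q) module_scheme \<Rightarrow> ('v \<Rightarrow> 'w \<Rightarrow> 'x) \<Rightarrow> bool" where
  "bilinear_map K V W X \<beta> \<longleftrightarrow>
     (\<forall>w\<in>carrier W. linear_map K V X (\<lambda>v. \<beta> v w)) \<and> (\<forall>v\<in>carrier V. linear_map K W X (\<beta> v))"

lemma vectorspace_field: "vectorspace K V \<Longrightarrow> field K"
  by (simp add: vectorspace_def)

lemma vectorspace_ring: "vectorspace K V \<Longrightarrow> ring K"
  by (simp add: vectorspace_def module_def cring_def)

lemma tensor_rels_cases: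
  assumes "r \<in> tensor_rels K V W"
  obtains (add_left) v v' w where "v \<in> carrier V" "v' \<in> carrier V" "w \<in> carrier W"
      "r = free_gen K (carrier V \<times> carrier W) (v \<oplus>\<^bsub>V\<^esub> v', w) \<ominus>\<^bsub>free_vs K (carrier V \<times> carrier W)\<^esub>
        (free_gen K (carrier V \<times> carrier W) (v, w) \<oplus>\<^bsub>free_vs K (carrier V \<times> carrier W)\<^esub>
         free_gen K (carrier V \<times> carrier W) (v', w))"
    | (add_right) v w w' where "v \<in> carrier V" "w \<in> carrier W" "w' \<in> carrier W"
      "r = free_gen K (carrier V \<times> carrier W) (v, w \<oplus>\<^bsub>W\<^esub> w') \<ominus>\<^bsub>free_vs K (carrier V \<times> carrier W)\<^esub>
        (free_gen K (carrier V \<times> carrier W) (v, w) \<oplus>\<^bsub>free_vs K (carrier V \<times> carrier W)\<^esub>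
         free_gen K (carrier V \<times> carrier W) (v, w'))"
    | (smult_left) a v w where "a \<in> carrier K" "v \<in> carrier V" "w \<in> carrier W"
      "r = free_gen K (carrier V \<times> carrier W) (a \<odot>\<^bsub>V\<^esub> v, w) \<ominus>\<^bsub>free_vs K (carrier V \<times> carrier W)\<^esub>
        a \<odot>\<^bsub>free_vs K (carrier V \<times> carrier W)\<^esub> free_gen K (carrier V \<times> carrier W) (v, w)"
    | (smult_right) a v w where "a \<in> carrier K" "v \<in> carrier V" "w \<in> carrier W"
      "r = free_gen K (carrier V \<times> carrier W) (v, a \<odot>\<^bsub>W\<^esub> w) \<ominus>\<^bsub>free_vs K (carrier V \<times> carrier W)\<^esub>
        a \<odot>\<^bsub>free_vs K (carrier V \<times> carrier W)\<^esub> free_gen K (carrier V \<times> carrier W) (v, w)"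
  using assms unfolding tensor_rels_def Let_def by blast

lemma tensor_rels_carrier:
  assumes V: "vectorspace K V" and W: "vectorspace K W"
  shows "tensor_rels K V W \<subseteq> carrier (free_vs K (carrier V \<times> carrier W))"
proof
  interpret V: vectorspace K V by (rule V)
  interpret W: vectorspace K W by (rule W)
  let ?F = "free_vs K (carrier V \<times> carrier W)"
  interpret F: vectorspace K ?F by (rule vectorspace_free_vs[OF vectorspace_field[OF V]])
  have gen: "free_gen K (carrier V \<times> carrier W) (v, w) \<in> carrier ?F"
    if "v \<in> carrier V" "w \<in> carrier W" for v w
    using that by (intro free_gen_closed vectorspace_ring[OF V]) auto
  fix r assume "r \<in> tensor_rels K V W"
  then show "r \<in> carrier ?F"
    by (cases rule: tensor_rels_cases)
      (simp_all only: F.M.minus_closed F.M.add.m_closed F.smult_closed gen V.M.add.m_closed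
        W.M.add.m_closed V.smult_closed W.smult_closed)
qed

lemma submodule_tensor_null:
  assumes "vectorspace K V" "vectorspace K W"
  shows "submodule K (tensor_null K V W) (free_vs K (carrier V \<times> carrier W))"
proof -
  interpret F: vectorspace K "free_vs K (carrier V \<times> carrier W)"
    by (rule vectorspace_free_vs[OF vectorspace_field[OF assms(1)]])
  show ?thesis unfolding tensor_null_def
    by (rule F.span_is_submodule[OF tensor_rels_carrier[OF assms]])
qed

lemma vectorspace_tensor:
  assumes "vectorspace K V" "vectorspace K W"
  shows "vectorspace K (V \<boxtimes>\<^bsub>K\<^esub> W)"
  unfolding tensor_vs_def
  by (rule vectorspace_quotient[OF vectorspace_free_vs[OF vectorspace_field[OF assms(1)]]
        submodule_tensor_null[OF assms]])

text \<open>Each family of generators of \<^const>\<open>tensor_null\<close> is the defect of one of the four bilinearity laws.\<close>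

lemma bilinear_pure_tensor:
  assumes V: "vectorspace K V" and W: "vectorspace K W"
  shows "bilinear_map K V W (V \<boxtimes>\<^bsub>K\<^esub> W) (pure_tensor K V W)"
proof -
  interpret V: vectorspace K V by (rule V)
  interpret W: vectorspace K W by (rule W)
  let ?S = "carrier V \<times> carrier W"
  let ?F = "free_vs K ?S"
  let ?e = "free_gen K ?S"
  let ?q = "\<lambda>x. tensor_null K V W +>\<^bsub>?F\<^esub> x"
  interpret F: vectorspace K ?F by (rule vectorspace_free_vs[OF vectorspace_field[OF V]])
  note N = submodule_tensor_null[OF V W]
  note q = linear_map_quotient_proj[OF F.vectorspace_axioms N, folded tensor_vs_def]
  note T = vectorspace_tensor[OF V W]
  have gen: "?e (v, w) \<in> carrier ?F" if "v \<in> carrier V" "w \<in> carrier W" for v w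
    using that by (intro free_gen_closed vectorspace_ring[OF V]) auto
  have rel: "?q x = ?q y" if "x \<ominus>\<^bsub>?F\<^esub> y \<in> tensor_rels K V W" "x \<in> carrier ?F" "y \<in> carrier ?F" for x y
  proof (rule quotient_eqI[OF N that(2,3)])
    show "x \<ominus>\<^bsub>?F\<^esub> y \<in> tensor_null K V W"
      using that(1) F.in_own_span[OF tensor_rels_carrier[OF V W]] unfolding tensor_null_def by blast
  qed
  have "linear_map K V (V \<boxtimes>\<^bsub>K\<^esub> W) (\<lambda>v. pure_tensor K V W v w)" if w: "w \<in> carrier W" for w
  proof (rule linear_mapI[OF V T])
    show "pure_tensor K V W v w \<in> carrier (V \<boxtimes>\<^bsub>K\<^esub> W)" if "v \<in> carrier V" for v
      unfolding pure_tensor_def by (rule linear_map_closed[OF q gen[OF that w]])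
    show "pure_tensor K V W (v \<oplus>\<^bsub>V\<^esub> v') w = pure_tensor K V W v w \<oplus>\<^bsub>V \<boxtimes>\<^bsub>K\<^esub> W\<^esub> pure_tensor K V W v' w"
      if v: "v \<in> carrier V" "v' \<in> carrier V" for v v'
    proof -
      have "?e (v \<oplus>\<^bsub>V\<^esub> v', w) \<ominus>\<^bsub>?F\<^esub> (?e (v, w) \<oplus>\<^bsub>?F\<^esub> ?e (v', w)) \<in> tensor_rels K V W"
        unfolding tensor_rels_def Let_def using v w by blast
      from rel[OF this] show ?thesis
        unfolding pure_tensor_def linear_map_add[OF q gen[OF v(1) w] gen[OF v(2) w], symmetric]
        using gen v w by (simp only: F.M.add.m_closed V.M.add.m_closed)
    qed
    show "pure_tensor K V W (a \<odot>\<^bsub>V\<^esub> v) w = a \<odot>\<^bsub>V \<boxtimes>\<^bsub>K\<^esub> W\<^esub> pure_tensor K V W v w"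
      if v: "a \<in> carrier K" "v \<in> carrier V" for a v
    proof -
      have "?e (a \<odot>\<^bsub>V\<^esub> v, w) \<ominus>\<^bsub>?F\<^esub> a \<odot>\<^bsub>?F\<^esub> ?e (v, w) \<in> tensor_rels K V W"
        unfolding tensor_rels_def Let_def using v w by blast
      from rel[OF this] show ?thesis
        unfolding pure_tensor_def linear_map_smult[OF q v(1) gen[OF v(2) w], symmetric]
        using gen v w by (simp only: F.smult_closed V.smult_closed)
    qed
  qed
  moreover have "linear_map K W (V \<boxtimes>\<^bsub>K\<^esub> W) (pure_tensor K V W v)" if v: "v \<in> carrier V" for v
  proof (rule linear_mapI[OF W T])
    show "pure_tensor K V W v w \<in> carrier (V \<boxtimes>\<^bsub>K\<^esub> W)" if "w \<in> carrier W" for w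
      unfolding pure_tensor_def by (rule linear_map_closed[OF q gen[OF v that]])
    show "pure_tensor K V W v (w \<oplus>\<^bsub>W\<^esub> w') = pure_tensor K V W v w \<oplus>\<^bsub>V \<boxtimes>\<^bsub>K\<^esub> W\<^esub> pure_tensor K V W v w'"
      if w: "w \<in> carrier W" "w' \<in> carrier W" for w w'
    proof -
      have "?e (v, w \<oplus>\<^bsub>W\<^esub> w') \<ominus>\<^bsub>?F\<^esub> (?e (v, w) \<oplus>\<^bsub>?F\<^esub> ?e (v, w')) \<in> tensor_rels K V W"
        unfolding tensor_rels_def Let_def using v w by blast
      from rel[OF this] show ?thesis
        unfolding pure_tensor_def linear_map_add[OF q gen[OF v w(1)] gen[OF v w(2)], symmetric]
        using gen v w by (simp only: F.M.add.m_closed W.M.add.m_closed)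
    qed
    show "pure_tensor K V W v (a \<odot>\<^bsub>W\<^esub> w) = a \<odot>\<^bsub>V \<boxtimes>\<^bsub>K\<^esub> W\<^esub> pure_tensor K V W v w"
      if w: "a \<in> carrier K" "w \<in> carrier W" for a w
    proof -
      have "?e (v, a \<odot>\<^bsub>W\<^esub> w) \<ominus>\<^bsub>?F\<^esub> a \<odot>\<^bsub>?F\<^esub> ?e (v, w) \<in> tensor_rels K V W"
        unfolding tensor_rels_def Let_def using v w by blast
      from rel[OF this] show ?thesis
        unfolding pure_tensor_def linear_map_smult[OF q w(1) gen[OF v w(2)], symmetric]
        using gen v w by (simp only: F.smult_closed W.smult_closed)
    qed
  qed
  ultimately show ?thesis unfolding bilinear_map_def by blast
qed

lemma pure_tensor_closed:
  assumes "vectorspace K V" "vectorspace K W" "v \<in> carrier V" "w \<in> carrier W"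
  shows "pure_tensor K V W v w \<in> carrier (V \<boxtimes>\<^bsub>K\<^esub> W)"
  using bilinear_pure_tensor[OF assms(1,2)] assms(3,4) linear_map_closed
  unfolding bilinear_map_def by fast

text \<open>The images of the generators span the quotient, so a linear map is determined by its values on
  pure tensors. Every identity between maps out of a tensor product below is checked in this way.\<close>

lemma tensor_eqI:
  assumes V: "vectorspace K V" and W: "vectorspace K W"
    and f: "linear_map K (V \<boxtimes>\<^bsub>K\<^esub> W) X f" and g: "linear_map K (V \<boxtimes>\<^bsub>K\<^esub> W) X g"
    and eq: "\<And>v w. v \<in> carrier V \<Longrightarrow> w \<in> carrier W \<Longrightarrow>
      f (pure_tensor K V W v w) = g (pure_tensor K V W v w)"
    and t: "t \<in> carrier (V \<boxtimes>\<^bsub>K\<^esub> W)"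
  shows "f t = g t"
proof -
  let ?S = "carrier V \<times> carrier W"
  let ?F = "free_vs K ?S"
  let ?q = "\<lambda>x. tensor_null K V W +>\<^bsub>?F\<^esub> x"
  interpret F: vectorspace K ?F by (rule vectorspace_free_vs[OF vectorspace_field[OF V]])
  note q = linear_map_quotient_proj[OF F.vectorspace_axioms submodule_tensor_null[OF V W], folded tensor_vs_def]
  have fq: "linear_map K ?F X (\<lambda>x. f (?q x))" and gq: "linear_map K ?F X (\<lambda>x. g (?q x))"
    using linear_map_comp[OF f q] linear_map_comp[OF g q] by (simp_all add: comp_def)
  interpret fq: linear_map K ?F X "\<lambda>x. f (?q x)" by (rule fq)
  interpret gq: linear_map K ?F X "\<lambda>x. g (?q x)" by (rule gq)
  obtain x where x: "x \<in> carrier ?F" and t': "t = ?q x"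
    using t by (auto simp: tensor_vs_def carrier_quotient)
  have "f (?q x) = g (?q x)"
    using vectorspace_field[OF V] x
  proof (induction rule: free_vs_induct)
    case zero
    show ?case by (simp only: fq.f0_is_0 gq.f0_is_0)
  next
    case (add a s x)
    obtain v w where s: "s = (v, w)" "v \<in> carrier V" "w \<in> carrier W" using add by auto
    have e: "free_gen K ?S s \<in> carrier ?F"
      using add by (intro free_gen_closed vectorspace_ring[OF V])
    have "f (?q (free_gen K ?S s)) = g (?q (free_gen K ?S s))"
      using eq[OF s(2,3)] by (simp add: pure_tensor_def s)
    with e add show ?case by (simp only: fq.f_add gq.f_add fq.f_smult gq.f_smult F.smult_closed)
  qed
  then show ?thesis by (simp add: t')
qed

text \<open>Bilinearity says that the linear extension of \<open>\<beta>\<close> to the free space kills the four families of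
  relations, hence their span, so it factors through the quotient.\<close>

lemma tensor_factor:
  assumes V: "vectorspace K V" and W: "vectorspace K W" and X: "vectorspace K X"
    and \<beta>: "bilinear_map K V W X \<beta>"
  obtains T where "linear_map K (V \<boxtimes>\<^bsub>K\<^esub> W) X T"
    and "\<And>v w. v \<in> carrier V \<Longrightarrow> w \<in> carrier W \<Longrightarrow> T (pure_tensor K V W v w) = \<beta> v w"
proof -
  interpret V: vectorspace K V by (rule V)
  interpret W: vectorspace K W by (rule W)
  interpret X: vectorspace K X by (rule X)
  let ?S = "carrier V \<times> carrier W"
  let ?F = "free_vs K ?S"
  let ?e = "free_gen K ?S"
  let ?\<phi> = "free_extend K ?S X (\<lambda>(v, w). \<beta> v w)"
  have l: "linear_map K V X (\<lambda>v. \<beta> v w)" if "w \<in> carrier W" for w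
    using \<beta> that by (simp add: bilinear_map_def)
  have r: "linear_map K W X (\<beta> v)" if "v \<in> carrier V" for v
    using \<beta> that by (simp add: bilinear_map_def)
  have \<beta>c: "\<beta> v w \<in> carrier X" if "v \<in> carrier V" "w \<in> carrier W" for v w
    by (rule linear_map_closed[OF l]) (rule that)+
  have h: "(\<lambda>(v, w). \<beta> v w) \<in> ?S \<rightarrow> carrier X" using \<beta>c by auto
  note \<phi> = linear_map_free_extend[OF X h]
  interpret F: vectorspace K ?F by (rule linear_map_dom[OF \<phi>])
  interpret \<phi>: linear_map K ?F X ?\<phi> by (rule \<phi>)
  have gen: "?e (v, w) \<in> carrier ?F" if "v \<in> carrier V" "w \<in> carrier W" for v w
    using that by (intro free_gen_closed vectorspace_ring[OF V]) auto
  have \<phi>e: "?\<phi> (?e (v, w)) = \<beta> v w" if "v \<in> carrier V" "w \<in> carrier W" for v w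
    using free_extend_gen[OF X h, of "(v, w)"] that by simp
  have "r \<in> \<phi>.ker" if "r \<in> tensor_rels K V W" for r
    using that
  proof (cases rule: tensor_rels_cases)
    case (add_left v v' w)
    then show ?thesis
      by (simp add: \<phi>.ker_def gen \<phi>e \<beta>c linear_map_add[OF l] del: free_vs_sel)
  next
    case (add_right v w w')
    then show ?thesis
      by (simp add: \<phi>.ker_def gen \<phi>e \<beta>c linear_map_add[OF r] del: free_vs_sel)
  next
    case (smult_left a v w)
    then show ?thesis
      by (simp add: \<phi>.ker_def gen \<phi>e \<beta>c linear_map_smult[OF l] del: free_vs_sel)
  next
    case (smult_right a v w)
    then show ?thesis
      by (simp add: \<phi>.ker_def gen \<phi>e \<beta>c linear_map_smult[OF r] del: free_vs_sel)
  qed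
  then have "tensor_null K V W \<subseteq> \<phi>.ker" unfolding tensor_null_def
    by (intro F.span_is_subset[OF _ \<phi>.ker_is_submodule]) blast
  then have "?\<phi> x = \<zero>\<^bsub>X\<^esub>" if "x \<in> tensor_null K V W" for x
    using that by (auto simp: \<phi>.ker_def)
  then obtain T where T: "linear_map K (V \<boxtimes>\<^bsub>K\<^esub> W) X T"
    and T': "\<And>x. x \<in> carrier ?F \<Longrightarrow> T (tensor_null K V W +>\<^bsub>?F\<^esub> x) = ?\<phi> x"
    using quotient_factor[OF \<phi> submodule_tensor_null[OF V W]] unfolding tensor_vs_def by blast
  show ?thesis
    by (rule that[OF T]) (simp add: pure_tensor_def T' gen \<phi>e)
qed

text \<open>\<^const>\<open>tensor_lift\<close> is a definite description: existence comes from the factorization, cut down to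
  the carrier, and uniqueness from the fact that pure tensors span.\<close>

lemma tensor_lift:
  assumes V: "vectorspace K V" and W: "vectorspace K W" and X: "vectorspace K X"
    and \<beta>: "bilinear_map K V W X \<beta>"
  shows linear_map_tensor_lift: "linear_map K (V \<boxtimes>\<^bsub>K\<^esub> W) X (tensor_lift K V W X \<beta>)"
    and tensor_lift_pure: "v \<in> carrier V \<Longrightarrow> w \<in> carrier W \<Longrightarrow>
      tensor_lift K V W X \<beta> (pure_tensor K V W v w) = \<beta> v w"
proof -
  obtain T where T: "linear_map K (V \<boxtimes>\<^bsub>K\<^esub> W) X T"
    and pure: "\<And>v w. v \<in> carrier V \<Longrightarrow> w \<in> carrier W \<Longrightarrow> T (pure_tensor K V W v w) = \<beta> v w"
    using tensor_factor[OF assms] by blast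
  let ?C = "carrier (V \<boxtimes>\<^bsub>K\<^esub> W)"
  let ?P = "\<lambda>T. linear_map K (V \<boxtimes>\<^bsub>K\<^esub> W) X T \<and> T \<in> extensional ?C \<and>
      (\<forall>v\<in>carrier V. \<forall>w\<in>carrier W. T (pure_tensor K V W v w) = \<beta> v w)"
  have "?P (tensor_lift K V W X \<beta>)" unfolding tensor_lift_def
  proof (rule theI[of ?P])
    show "?P (restrict T ?C)"
      using linear_map_cong[OF T] pure pure_tensor_closed[OF V W] by simp
    fix U assume U: "?P U"
    show "U = restrict T ?C"
    proof (rule extensionalityI[of _ ?C])
      fix t assume t: "t \<in> ?C"
      have "U t = T t" by (rule tensor_eqI[OF V W _ T _ t]) (use U pure in auto)
      then show "U t = restrict T ?C t" using t by simp
    qed (use U in auto)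
  qed
  then show "linear_map K (V \<boxtimes>\<^bsub>K\<^esub> W) X (tensor_lift K V W X \<beta>)"
    and "v \<in> carrier V \<Longrightarrow> w \<in> carrier W \<Longrightarrow>
      tensor_lift K V W X \<beta> (pure_tensor K V W v w) = \<beta> v w" by auto
qed

section \<open>Structural maps on pure tensors\<close>

lemma linear_map_plus:
  assumes f: "linear_map K V X f" and g: "linear_map K V X g"
  shows "linear_map K V X (\<lambda>v. f v \<oplus>\<^bsub>X\<^esub> g v)"
proof -
  interpret X: vectorspace K X by (rule linear_map_cod[OF f])
  note [simp] = linear_map_closed[OF f] linear_map_closed[OF g]
  show ?thesis
    by (rule linear_mapI[OF linear_map_dom[OF f] X.vectorspace_axioms])
      (simp_all add: linear_map_add[OF f] linear_map_add[OF g] linear_map_smult[OF f]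
        linear_map_smult[OF g] X.M.a_ac X.smult_r_distr)
qed

lemma linear_map_scale:
  assumes f: "linear_map K V X f" and a: "a \<in> carrier K"
  shows "linear_map K V X (\<lambda>v. a \<odot>\<^bsub>X\<^esub> f v)"
proof -
  interpret X: vectorspace K X by (rule linear_map_cod[OF f])
  note [simp] = linear_map_closed[OF f]
  have "a \<odot>\<^bsub>X\<^esub> (b \<odot>\<^bsub>X\<^esub> x) = b \<odot>\<^bsub>X\<^esub> (a \<odot>\<^bsub>X\<^esub> x)" if "b \<in> carrier K" "x \<in> carrier X" for b x
    using that a by (simp add: X.smult_assoc1[symmetric] X.R.m_comm)
  then show ?thesis
    by (intro linear_mapI[OF linear_map_dom[OF f] X.vectorspace_axioms])
      (simp_all add: a linear_map_add[OF f] linear_map_smult[OF f] X.smult_r_distr)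
qed

lemma bilinear_map_flip:
  "bilinear_map K V W X \<beta> \<Longrightarrow> bilinear_map K W V X (\<lambda>w v. \<beta> v w)"
  by (auto simp: bilinear_map_def)

text \<open>The associators are lifts of lifts. For the outer lift to exist, the inner one has to depend
  linearly on its parameter \<open>w\<close>; as an identity of linear maps on \<open>U \<otimes> V\<close> this may be checked on pure
  tensors, where it is linearity of \<open>\<gamma>\<close> in \<open>w\<close>.\<close>

lemma bilinear_map_tensor_lift:
  assumes U: "vectorspace K U" and V: "vectorspace K V" and W: "vectorspace K W"
    and X: "vectorspace K X"
    and \<gamma>: "\<And>w. w \<in> carrier W \<Longrightarrow> bilinear_map K U V X (\<gamma> w)"
    and \<gamma>': "\<And>u v. u \<in> carrier U \<Longrightarrow> v \<in> carrier V \<Longrightarrow> linear_map K W X (\<lambda>w. \<gamma> w u v)"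
  shows "bilinear_map K (U \<boxtimes>\<^bsub>K\<^esub> V) W X (\<lambda>t w. tensor_lift K U V X (\<gamma> w) t)"
proof -
  interpret W: vectorspace K W by (rule W)
  note lin = linear_map_tensor_lift[OF U V X \<gamma>]
  note pure = tensor_lift_pure[OF U V X \<gamma>]
  have "linear_map K W X (\<lambda>w. tensor_lift K U V X (\<gamma> w) t)" if t: "t \<in> carrier (U \<boxtimes>\<^bsub>K\<^esub> V)" for t
  proof (rule linear_mapI[OF W X])
    fix w w' assume w: "w \<in> carrier W" "w' \<in> carrier W"
    show "tensor_lift K U V X (\<gamma> (w \<oplus>\<^bsub>W\<^esub> w')) t
      = tensor_lift K U V X (\<gamma> w) t \<oplus>\<^bsub>X\<^esub> tensor_lift K U V X (\<gamma> w') t"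
      by (rule tensor_eqI[OF U V lin linear_map_plus[OF lin lin] _ t])
        (use w in \<open>simp_all add: pure linear_map_add[OF \<gamma>']\<close>)
  next
    fix a w assume w: "a \<in> carrier K" "w \<in> carrier W"
    show "tensor_lift K U V X (\<gamma> (a \<odot>\<^bsub>W\<^esub> w)) t = a \<odot>\<^bsub>X\<^esub> tensor_lift K U V X (\<gamma> w) t"
      by (rule tensor_eqI[OF U V lin linear_map_scale[OF lin] _ t])
        (use w in \<open>simp_all add: pure linear_map_smult[OF \<gamma>']\<close>)
  qed (rule linear_map_closed[OF lin t])
  then show ?thesis by (simp add: bilinear_map_def lin)
qed

lemma linear_map_pure:
  assumes "vectorspace K V" "vectorspace K W"
  shows linear_map_pure_left: "w \<in> carrier W \<Longrightarrow> linear_map K V (V \<boxtimes>\<^bsub>K\<^esub> W) (\<lambda>v. pure_tensor K V W v w)"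
    and linear_map_pure_right: "v \<in> carrier V \<Longrightarrow> linear_map K W (V \<boxtimes>\<^bsub>K\<^esub> W) (pure_tensor K V W v)"
  using bilinear_pure_tensor[OF assms] by (simp_all add: bilinear_map_def)

lemmas [simp] = vectorspace_tensor vectorspace_ground pure_tensor_closed linear_map_id

lemma bilinear_map_pure_comp:
  assumes f: "linear_map K V V' f" and g: "linear_map K W W' g"
  shows "bilinear_map K V W (V' \<boxtimes>\<^bsub>K\<^esub> W') (\<lambda>v w. pure_tensor K V' W' (f v) (g w))"
  unfolding bilinear_map_def
proof (intro conjI ballI)
  note vs = linear_map_cod[OF f] linear_map_cod[OF g]
  fix w assume "w \<in> carrier W"
  then show "linear_map K V (V' \<boxtimes>\<^bsub>K\<^esub> W') (\<lambda>v. pure_tensor K V' W' (f v) (g w))"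
    using linear_map_comp[OF linear_map_pure_left[OF vs, of "g w"] f] linear_map_closed[OF g]
    by (simp add: comp_def)
next
  note vs = linear_map_cod[OF f] linear_map_cod[OF g]
  fix v assume "v \<in> carrier V"
  then show "linear_map K W (V' \<boxtimes>\<^bsub>K\<^esub> W') (\<lambda>w. pure_tensor K V' W' (f v) (g w))"
    using linear_map_comp[OF linear_map_pure_right[OF vs, of "f v"] g] linear_map_closed[OF f]
    by (simp add: comp_def)
qed

lemma tensor_map:
  assumes f: "linear_map K V V' f" and g: "linear_map K W W' g"
  shows linear_map_tensor_map:
      "linear_map K (V \<boxtimes>\<^bsub>K\<^esub> W) (V' \<boxtimes>\<^bsub>K\<^esub> W') (tensor_map K V W V' W' f g)"
    and tensor_map_pure [simp]: "v \<in> carrier V \<Longrightarrow> w \<in> carrier W \<Longrightarrow>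
      tensor_map K V W V' W' f g (pure_tensor K V W v w) = pure_tensor K V' W' (f v) (g w)"
  unfolding tensor_map_def
  using tensor_lift[OF linear_map_dom[OF f] linear_map_dom[OF g] _ bilinear_map_pure_comp[OF f g]]
    linear_map_cod[OF f] linear_map_cod[OF g] by simp_all

lemma assoc:
  assumes U: "vectorspace K U" and V: "vectorspace K V" and W: "vectorspace K W"
  shows linear_map_assoc:
      "linear_map K (U \<boxtimes>\<^bsub>K\<^esub> V \<boxtimes>\<^bsub>K\<^esub> W) (U \<boxtimes>\<^bsub>K\<^esub> (V \<boxtimes>\<^bsub>K\<^esub> W)) (assoc K U V W)"
    and assoc_pure [simp]: "u \<in> carrier U \<Longrightarrow> v \<in> carrier V \<Longrightarrow> w \<in> carrier W \<Longrightarrow>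
      assoc K U V W (pure_tensor K (U \<boxtimes>\<^bsub>K\<^esub> V) W (pure_tensor K U V u v) w) =
        pure_tensor K U (V \<boxtimes>\<^bsub>K\<^esub> W) u (pure_tensor K V W v w)"
proof -
  let ?\<gamma> = "\<lambda>w u v. pure_tensor K U (V \<boxtimes>\<^bsub>K\<^esub> W) u (pure_tensor K V W v w)"
  let ?X = "U \<boxtimes>\<^bsub>K\<^esub> (V \<boxtimes>\<^bsub>K\<^esub> W)"
  note UV = vectorspace_tensor[OF U V] and VW = vectorspace_tensor[OF V W]
  note X = vectorspace_tensor[OF U VW]
  have \<gamma>: "bilinear_map K U V ?X (?\<gamma> w)" if "w \<in> carrier W" for w
    using bilinear_map_pure_comp[OF linear_map_id[OF U] linear_map_pure_left[OF V W that]] by simp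
  have \<gamma>': "linear_map K W ?X (\<lambda>w. ?\<gamma> w u v)" if "u \<in> carrier U" "v \<in> carrier V" for u v
    using linear_map_comp[OF linear_map_pure_right[OF U VW that(1)] linear_map_pure_right[OF V W that(2)]]
    by (simp add: comp_def)
  note bil = bilinear_map_tensor_lift[OF U V W X \<gamma> \<gamma>', simplified]
  show "linear_map K (U \<boxtimes>\<^bsub>K\<^esub> V \<boxtimes>\<^bsub>K\<^esub> W) ?X (assoc K U V W)"
    unfolding assoc_def by (rule linear_map_tensor_lift[OF UV W X bil])
  show "assoc K U V W (pure_tensor K (U \<boxtimes>\<^bsub>K\<^esub> V) W (pure_tensor K U V u v) w) = ?\<gamma> w u v"
    if "u \<in> carrier U" "v \<in> carrier V" "w \<in> carrier W"
    unfolding assoc_def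
    by (subst tensor_lift_pure[OF UV W X bil])
      (use that in \<open>simp_all add: U V tensor_lift_pure[OF U V X \<gamma>]\<close>)
qed

lemma assoc_inv:
  assumes U: "vectorspace K U" and V: "vectorspace K V" and W: "vectorspace K W"
  shows linear_map_assoc_inv:
      "linear_map K (U \<boxtimes>\<^bsub>K\<^esub> (V \<boxtimes>\<^bsub>K\<^esub> W)) (U \<boxtimes>\<^bsub>K\<^esub> V \<boxtimes>\<^bsub>K\<^esub> W) (assoc_inv K U V W)"
    and assoc_inv_pure [simp]: "u \<in> carrier U \<Longrightarrow> v \<in> carrier V \<Longrightarrow> w \<in> carrier W \<Longrightarrow>
      assoc_inv K U V W (pure_tensor K U (V \<boxtimes>\<^bsub>K\<^esub> W) u (pure_tensor K V W v w)) =
        pure_tensor K (U \<boxtimes>\<^bsub>K\<^esub> V) W (pure_tensor K U V u v) w"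
proof -
  let ?\<gamma> = "\<lambda>u v w. pure_tensor K (U \<boxtimes>\<^bsub>K\<^esub> V) W (pure_tensor K U V u v) w"
  let ?X = "U \<boxtimes>\<^bsub>K\<^esub> V \<boxtimes>\<^bsub>K\<^esub> W"
  note UV = vectorspace_tensor[OF U V] and VW = vectorspace_tensor[OF V W]
  note X = vectorspace_tensor[OF UV W]
  have \<gamma>: "bilinear_map K V W ?X (?\<gamma> u)" if "u \<in> carrier U" for u
    using bilinear_map_pure_comp[OF linear_map_pure_right[OF U V that] linear_map_id[OF W]] by simp
  have \<gamma>': "linear_map K U ?X (\<lambda>u. ?\<gamma> u v w)" if "v \<in> carrier V" "w \<in> carrier W" for v w
    using linear_map_comp[OF linear_map_pure_left[OF UV W that(2)] linear_map_pure_left[OF U V that(1)]]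
    by (simp add: comp_def)
  note bil = bilinear_map_flip[OF bilinear_map_tensor_lift[OF V W U X \<gamma> \<gamma>', simplified]]
  show "linear_map K (U \<boxtimes>\<^bsub>K\<^esub> (V \<boxtimes>\<^bsub>K\<^esub> W)) ?X (assoc_inv K U V W)"
    unfolding assoc_inv_def by (rule linear_map_tensor_lift[OF U VW X bil])
  show "assoc_inv K U V W (pure_tensor K U (V \<boxtimes>\<^bsub>K\<^esub> W) u (pure_tensor K V W v w)) = ?\<gamma> u v w"
    if "u \<in> carrier U" "v \<in> carrier V" "w \<in> carrier W"
    unfolding assoc_inv_def
    by (subst tensor_lift_pure[OF U VW X bil])
      (use that in \<open>simp_all add: V W tensor_lift_pure[OF V W X \<gamma>]\<close>)
qed

lemma bilinear_map_smult:
  assumes "vectorspace K V"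
  shows "bilinear_map K (ground_vs K) V V (\<lambda>a v. a \<odot>\<^bsub>V\<^esub> v)"
proof -
  interpret V: vectorspace K V by fact
  have "linear_map K V V (\<lambda>v. a \<odot>\<^bsub>V\<^esub> v)" if "a \<in> carrier K" for a
    using linear_map_scale[OF linear_map_id[OF assms] that] by simp
  moreover have "linear_map K (ground_vs K) V (\<lambda>a. a \<odot>\<^bsub>V\<^esub> v)" if "v \<in> carrier V" for v
    by (rule linear_mapI[OF vectorspace_ground assms])
      (use that V.field_axioms in \<open>simp_all add: V.smult_l_distr V.smult_assoc1\<close>)
  ultimately show ?thesis by (simp add: bilinear_map_def)
qed

lemma lunit:
  assumes V: "vectorspace K V"
  shows linear_map_lunit: "linear_map K (ground_vs K \<boxtimes>\<^bsub>K\<^esub> V) V (lunit K V)"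
    and lunit_pure [simp]: "a \<in> carrier K \<Longrightarrow> v \<in> carrier V \<Longrightarrow>
      lunit K V (pure_tensor K (ground_vs K) V a v) = a \<odot>\<^bsub>V\<^esub> v"
  unfolding lunit_def
  using tensor_lift[OF vectorspace_ground[OF vectorspace_field[OF V]] V V bilinear_map_smult[OF V]]
  by simp_all

lemma runit:
  assumes V: "vectorspace K V"
  shows linear_map_runit: "linear_map K (V \<boxtimes>\<^bsub>K\<^esub> ground_vs K) V (runit K V)"
    and runit_pure [simp]: "a \<in> carrier K \<Longrightarrow> v \<in> carrier V \<Longrightarrow>
      runit K V (pure_tensor K V (ground_vs K) v a) = a \<odot>\<^bsub>V\<^esub> v"
  unfolding runit_def
  using tensor_lift[OF V vectorspace_ground[OF vectorspace_field[OF V]] V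
      bilinear_map_flip[OF bilinear_map_smult[OF V]]]
  by simp_all

text \<open>For linearity goals about composites. The intermediate spaces start out schematic, so the rules are
  applied with \<open>rule\<close>, which may instantiate them, and the composition rule treats the outer map first.\<close>

lemmas linear_map_intros = linear_map_comp linear_map_id linear_map_tensor_map linear_map_assoc
  linear_map_assoc_inv linear_map_lunit linear_map_runit linear_map_pure_left linear_map_pure_right
  vectorspace_tensor vectorspace_ground

lemma join_mid:
  assumes "vectorspace K U" "vectorspace K V" "vectorspace K W" "vectorspace K X"
  shows linear_map_join_mid:
      "linear_map K (U \<boxtimes>\<^bsub>K\<^esub> V \<boxtimes>\<^bsub>K\<^esub> (W \<boxtimes>\<^bsub>K\<^esub> X)) (U \<boxtimes>\<^bsub>K\<^esub> (V \<boxtimes>\<^bsub>K\<^esub> W \<boxtimes>\<^bsub>K\<^esub> X)) (join_mid K U V W X)"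
    and join_mid_pure [simp]:
      "u \<in> carrier U \<Longrightarrow> v \<in> carrier V \<Longrightarrow> w \<in> carrier W \<Longrightarrow> x \<in> carrier X \<Longrightarrow>
      join_mid K U V W X (pure_tensor K (U \<boxtimes>\<^bsub>K\<^esub> V) (W \<boxtimes>\<^bsub>K\<^esub> X) (pure_tensor K U V u v) (pure_tensor K W X w x)) =
        pure_tensor K U (V \<boxtimes>\<^bsub>K\<^esub> W \<boxtimes>\<^bsub>K\<^esub> X) u (pure_tensor K (V \<boxtimes>\<^bsub>K\<^esub> W) X (pure_tensor K V W v w) x)"
  unfolding join_mid_def using assms
  by (auto intro!: linear_map_intros simp: linear_map_assoc_inv)

lemma split_mid:
  assumes "vectorspace K U" "vectorspace K V" "vectorspace K W" "vectorspace K X"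
  shows linear_map_split_mid:
      "linear_map K (U \<boxtimes>\<^bsub>K\<^esub> (V \<boxtimes>\<^bsub>K\<^esub> W \<boxtimes>\<^bsub>K\<^esub> X)) (U \<boxtimes>\<^bsub>K\<^esub> V \<boxtimes>\<^bsub>K\<^esub> (W \<boxtimes>\<^bsub>K\<^esub> X)) (split_mid K U V W X)"
    and split_mid_pure [simp]:
      "u \<in> carrier U \<Longrightarrow> v \<in> carrier V \<Longrightarrow> w \<in> carrier W \<Longrightarrow> x \<in> carrier X \<Longrightarrow>
      split_mid K U V W X (pure_tensor K U (V \<boxtimes>\<^bsub>K\<^esub> W \<boxtimes>\<^bsub>K\<^esub> X) u (pure_tensor K (V \<boxtimes>\<^bsub>K\<^esub> W) X (pure_tensor K V W v w) x)) =
        pure_tensor K (U \<boxtimes>\<^bsub>K\<^esub> V) (W \<boxtimes>\<^bsub>K\<^esub> X) (pure_tensor K U V u v) (pure_tensor K W X w x)"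
  unfolding split_mid_def using assms
  by (auto intro!: linear_map_intros simp: linear_map_assoc)

section \<open>Linear maps on iterated tensor products\<close>

text \<open>Maps out of an iterated tensor product are compared on iterated pure tensors: fixing one
  argument of a pure tensor is linear, so the two-fold comparison applies once more to the other.\<close>

lemma tensor_left_nested_eqI:
  assumes U: "vectorspace K U" and V: "vectorspace K V" and W: "vectorspace K W"
    and f: "linear_map K (U \<boxtimes>\<^bsub>K\<^esub> V \<boxtimes>\<^bsub>K\<^esub> W) Y f" and g: "linear_map K (U \<boxtimes>\<^bsub>K\<^esub> V \<boxtimes>\<^bsub>K\<^esub> W) Y g"
    and eq: "\<And>u v w. u \<in> carrier U \<Longrightarrow> v \<in> carrier V \<Longrightarrow> w \<in> carrier W \<Longrightarrow>
      f (pure_tensor K (U \<boxtimes>\<^bsub>K\<^esub> V) W (pure_tensor K U V u v) w)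
        = g (pure_tensor K (U \<boxtimes>\<^bsub>K\<^esub> V) W (pure_tensor K U V u v) w)"
    and t: "t \<in> carrier (U \<boxtimes>\<^bsub>K\<^esub> V \<boxtimes>\<^bsub>K\<^esub> W)"
  shows "f t = g t"
proof (rule tensor_eqI[OF vectorspace_tensor[OF U V] W f g _ t])
  fix s w assume s: "s \<in> carrier (U \<boxtimes>\<^bsub>K\<^esub> V)" and w: "w \<in> carrier W"
  note p = linear_map_pure_left[OF vectorspace_tensor[OF U V] W w]
  show "f (pure_tensor K (U \<boxtimes>\<^bsub>K\<^esub> V) W s w) = g (pure_tensor K (U \<boxtimes>\<^bsub>K\<^esub> V) W s w)"
    using tensor_eqI[OF U V linear_map_comp[OF f p] linear_map_comp[OF g p] _ s] eq w by simp
qed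

lemma tensor_right_nested_eqI:
  assumes U: "vectorspace K U" and V: "vectorspace K V" and W: "vectorspace K W"
    and f: "linear_map K (U \<boxtimes>\<^bsub>K\<^esub> (V \<boxtimes>\<^bsub>K\<^esub> W)) Y f" and g: "linear_map K (U \<boxtimes>\<^bsub>K\<^esub> (V \<boxtimes>\<^bsub>K\<^esub> W)) Y g"
    and eq: "\<And>u v w. u \<in> carrier U \<Longrightarrow> v \<in> carrier V \<Longrightarrow> w \<in> carrier W \<Longrightarrow>
      f (pure_tensor K U (V \<boxtimes>\<^bsub>K\<^esub> W) u (pure_tensor K V W v w))
        = g (pure_tensor K U (V \<boxtimes>\<^bsub>K\<^esub> W) u (pure_tensor K V W v w))"
    and t: "t \<in> carrier (U \<boxtimes>\<^bsub>K\<^esub> (V \<boxtimes>\<^bsub>K\<^esub> W))"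
  shows "f t = g t"
proof (rule tensor_eqI[OF U vectorspace_tensor[OF V W] f g _ t])
  fix u s assume u: "u \<in> carrier U" and s: "s \<in> carrier (V \<boxtimes>\<^bsub>K\<^esub> W)"
  note p = linear_map_pure_right[OF U vectorspace_tensor[OF V W] u]
  show "f (pure_tensor K U (V \<boxtimes>\<^bsub>K\<^esub> W) u s) = g (pure_tensor K U (V \<boxtimes>\<^bsub>K\<^esub> W) u s)"
    using tensor_eqI[OF V W linear_map_comp[OF f p] linear_map_comp[OF g p] _ s] eq u by simp
qed

lemma tensor_both_nested_eqI:
  assumes U: "vectorspace K U" and V: "vectorspace K V" and W: "vectorspace K W" and X: "vectorspace K X"
    and f: "linear_map K (U \<boxtimes>\<^bsub>K\<^esub> V \<boxtimes>\<^bsub>K\<^esub> (W \<boxtimes>\<^bsub>K\<^esub> X)) Y f"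
    and g: "linear_map K (U \<boxtimes>\<^bsub>K\<^esub> V \<boxtimes>\<^bsub>K\<^esub> (W \<boxtimes>\<^bsub>K\<^esub> X)) Y g"
    and eq: "\<And>u v w x. u \<in> carrier U \<Longrightarrow> v \<in> carrier V \<Longrightarrow> w \<in> carrier W \<Longrightarrow> x \<in> carrier X \<Longrightarrow>
      f (pure_tensor K (U \<boxtimes>\<^bsub>K\<^esub> V) (W \<boxtimes>\<^bsub>K\<^esub> X) (pure_tensor K U V u v) (pure_tensor K W X w x))
        = g (pure_tensor K (U \<boxtimes>\<^bsub>K\<^esub> V) (W \<boxtimes>\<^bsub>K\<^esub> X) (pure_tensor K U V u v) (pure_tensor K W X w x))"
    and t: "t \<in> carrier (U \<boxtimes>\<^bsub>K\<^esub> V \<boxtimes>\<^bsub>K\<^esub> (W \<boxtimes>\<^bsub>K\<^esub> X))"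
  shows "f t = g t"
proof (rule tensor_left_nested_eqI[OF U V vectorspace_tensor[OF W X] f g _ t])
  fix u v s assume u: "u \<in> carrier U" and v: "v \<in> carrier V" and s: "s \<in> carrier (W \<boxtimes>\<^bsub>K\<^esub> X)"
  note p = linear_map_pure_right[OF vectorspace_tensor[OF U V] vectorspace_tensor[OF W X]
      pure_tensor_closed[OF U V u v]]
  show "f (pure_tensor K (U \<boxtimes>\<^bsub>K\<^esub> V) (W \<boxtimes>\<^bsub>K\<^esub> X) (pure_tensor K U V u v) s)
      = g (pure_tensor K (U \<boxtimes>\<^bsub>K\<^esub> V) (W \<boxtimes>\<^bsub>K\<^esub> X) (pure_tensor K U V u v) s)"
    using tensor_eqI[OF W X linear_map_comp[OF f p] linear_map_comp[OF g p] _ s] eq u v by simp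
qed

lemma tensor_map_comp:
  assumes f: "linear_map K V V' f" and g: "linear_map K W W' g"
    and f': "linear_map K V' V'' f'" and g': "linear_map K W' W'' g'"
    and t: "t \<in> carrier (V \<boxtimes>\<^bsub>K\<^esub> W)"
  shows "tensor_map K V' W' V'' W'' f' g' (tensor_map K V W V' W' f g t)
    = tensor_map K V W V'' W'' (f' \<circ> f) (g' \<circ> g) t"
proof -
  note vs = linear_map_dom[OF f] linear_map_dom[OF g]
  have "(tensor_map K V' W' V'' W'' f' g' \<circ> tensor_map K V W V' W' f g) t
    = tensor_map K V W V'' W'' (f' \<circ> f) (g' \<circ> g) t"
  proof (rule tensor_eqI[OF vs _ _ _ t], goal_cases)
    case (3 v w)
    then show ?case
      by (simp add: f g f' g' linear_map_comp[OF f' f, unfolded comp_def]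
          linear_map_comp[OF g' g, unfolded comp_def]
          linear_map_closed[OF f] linear_map_closed[OF g])
  qed (rule linear_map_intros f g f' g')+
  then show ?thesis by simp
qed

text \<open>Together with the next rule, this moves one coproduct of \<open>\<Delta>\<^sub>C \<otimes> \<Delta>\<^sub>D\<close> past the rebracketing, into the
  argument of a contraction.\<close>

lemma assoc_inv_natural:
  assumes f: "linear_map K U U' f" and V: "vectorspace K V" and W: "vectorspace K W"
    and t: "t \<in> carrier (U \<boxtimes>\<^bsub>K\<^esub> (V \<boxtimes>\<^bsub>K\<^esub> W))"
  shows "assoc_inv K U' V W (tensor_map K U (V \<boxtimes>\<^bsub>K\<^esub> W) U' (V \<boxtimes>\<^bsub>K\<^esub> W) f id t)
    = tensor_map K (U \<boxtimes>\<^bsub>K\<^esub> V) W (U' \<boxtimes>\<^bsub>K\<^esub> V) W (tensor_map K U V U' V f id) id (assoc_inv K U V W t)"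
proof -
  note vs [simp] = linear_map_dom[OF f] linear_map_cod[OF f] V W
  have "(assoc_inv K U' V W \<circ> tensor_map K U (V \<boxtimes>\<^bsub>K\<^esub> W) U' (V \<boxtimes>\<^bsub>K\<^esub> W) f id) t
    = (tensor_map K (U \<boxtimes>\<^bsub>K\<^esub> V) W (U' \<boxtimes>\<^bsub>K\<^esub> V) W (tensor_map K U V U' V f id) id \<circ> assoc_inv K U V W) t"
  proof (rule tensor_right_nested_eqI[OF vs(1) V W _ _ _ t], goal_cases)
    case (3 u v w)
    then show ?case by (simp add: f linear_map_closed[OF f] linear_map_tensor_map)
  qed (rule linear_map_intros f vs)+
  then show ?thesis by simp
qed

lemma assoc_natural:
  assumes U: "vectorspace K U" and V: "vectorspace K V" and g: "linear_map K W W' g"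
    and t: "t \<in> carrier (U \<boxtimes>\<^bsub>K\<^esub> V \<boxtimes>\<^bsub>K\<^esub> W)"
  shows "assoc K U V W' (tensor_map K (U \<boxtimes>\<^bsub>K\<^esub> V) W (U \<boxtimes>\<^bsub>K\<^esub> V) W' id g t)
    = tensor_map K U (V \<boxtimes>\<^bsub>K\<^esub> W) U (V \<boxtimes>\<^bsub>K\<^esub> W') id (tensor_map K V W V W' id g) (assoc K U V W t)"
proof -
  note vs [simp] = linear_map_dom[OF g] linear_map_cod[OF g] U V
  have "(assoc K U V W' \<circ> tensor_map K (U \<boxtimes>\<^bsub>K\<^esub> V) W (U \<boxtimes>\<^bsub>K\<^esub> V) W' id g) t
    = (tensor_map K U (V \<boxtimes>\<^bsub>K\<^esub> W) U (V \<boxtimes>\<^bsub>K\<^esub> W') id (tensor_map K V W V W' id g) \<circ> assoc K U V W) t"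
  proof (rule tensor_left_nested_eqI[OF U V vs(1) _ _ _ t], goal_cases)
    case (3 u v w)
    then show ?case by (simp add: g linear_map_closed[OF g] linear_map_tensor_map)
  qed (rule linear_map_intros g vs)+
  then show ?thesis by simp
qed

section \<open>Contracting a twisted product\<close>

text \<open>In Sweedler notation, \<open>contract_left\<close> sends \<open>(u \<otimes> v) \<otimes> w\<close> to \<open>e (u \<otimes> w\<^sup>\<Psi>) v\<^sup>\<Psi>\<close>, and
  \<open>contract_right\<close> sends \<open>v \<otimes> (w \<otimes> x)\<close> to \<open>e (v\<^sup>\<Psi> \<otimes> x) w\<^sup>\<Psi>\<close>. Composed with the coproducts of \<open>C\<close>
  and of \<open>D\<close> they are the left-hand sides of right and left conormality, with \<open>e = \<epsilon>\<^sub>Z\<close>.\<close>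

definition contract_left where
  "contract_left K U V W W' V' e \<Psi> =
     lunit K V' \<circ> tensor_map K (U \<boxtimes>\<^bsub>K\<^esub> W') V' (ground_vs K) V' e id
     \<circ> assoc_inv K U W' V' \<circ> tensor_map K U (V \<boxtimes>\<^bsub>K\<^esub> W) U (W' \<boxtimes>\<^bsub>K\<^esub> V') id \<Psi> \<circ> assoc K U V W"

definition contract_right where
  "contract_right K V W X W' V' e \<Psi> =
     runit K W' \<circ> tensor_map K W' (V' \<boxtimes>\<^bsub>K\<^esub> X) W' (ground_vs K) id e
     \<circ> assoc K W' V' X \<circ> tensor_map K (V \<boxtimes>\<^bsub>K\<^esub> W) X (W' \<boxtimes>\<^bsub>K\<^esub> V') X \<Psi> id \<circ> assoc_inv K V W X"

text \<open>The map \<open>id \<otimes> \<Psi> \<otimes> id\<close> in the bracketing \<open>(U \<otimes> V) \<otimes> (W \<otimes> X)\<close>; the twisted coproduct is its composite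
  with \<open>\<Delta>\<^sub>C \<otimes> \<Delta>\<^sub>D\<close>.\<close>

definition twist_mid where
  "twist_mid K U V W X W' V' \<Psi> =
     split_mid K U W' V' X
     \<circ> tensor_map K U (V \<boxtimes>\<^bsub>K\<^esub> W \<boxtimes>\<^bsub>K\<^esub> X) U (W' \<boxtimes>\<^bsub>K\<^esub> V' \<boxtimes>\<^bsub>K\<^esub> X) id
         (tensor_map K (V \<boxtimes>\<^bsub>K\<^esub> W) X (W' \<boxtimes>\<^bsub>K\<^esub> V') X \<Psi> id)
     \<circ> join_mid K U V W X"

locale twisted_contraction =
  fixes K :: "('a, 'm) ring_scheme"
    and U :: "('a, 'u, 'n1) module_scheme"
    and V :: "('a, 'v, 'n2) module_scheme" and W :: "('a, 'w, 'n3) module_scheme"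
    and X :: "('a, 'x, 'n4) module_scheme"
    and W' :: "('a, 'w2, 'n5) module_scheme"
    and V' :: "('a, 'v2, 'n6) module_scheme"
    and \<Psi> :: "('a, 'v, 'w) tensor \<Rightarrow> ('a, 'w2, 'v2) tensor"
  assumes vs: "vectorspace K U" "vectorspace K V" "vectorspace K W" "vectorspace K X"
      "vectorspace K W'" "vectorspace K V'"
    and \<Psi>: "linear_map K (V \<boxtimes>\<^bsub>K\<^esub> W) (W' \<boxtimes>\<^bsub>K\<^esub> V') \<Psi>"
begin

lemma field_K: "field K"
  by (rule vectorspace_field[OF vs(1)])

lemmas lin_intros = linear_map_intros vs \<Psi> field_K linear_map_join_mid linear_map_split_mid
lemmas lin_simps = vs \<Psi> field_K linear_map_closed[OF \<Psi>] linear_map_tensor_map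

lemma linear_contract_left:
  assumes e: "linear_map K (U \<boxtimes>\<^bsub>K\<^esub> W') (ground_vs K) e"
  shows "linear_map K (U \<boxtimes>\<^bsub>K\<^esub> V \<boxtimes>\<^bsub>K\<^esub> W) V' (contract_left K U V W W' V' e \<Psi>)"
  unfolding contract_left_def by (rule lin_intros e)+

lemma linear_contract_right:
  assumes e: "linear_map K (V' \<boxtimes>\<^bsub>K\<^esub> X) (ground_vs K) e"
  shows "linear_map K (V \<boxtimes>\<^bsub>K\<^esub> (W \<boxtimes>\<^bsub>K\<^esub> X)) W' (contract_right K V W X W' V' e \<Psi>)"
  unfolding contract_right_def by (rule lin_intros e)+

lemma linear_twist_mid:
  "linear_map K (U \<boxtimes>\<^bsub>K\<^esub> V \<boxtimes>\<^bsub>K\<^esub> (W \<boxtimes>\<^bsub>K\<^esub> X)) (U \<boxtimes>\<^bsub>K\<^esub> W' \<boxtimes>\<^bsub>K\<^esub> (V' \<boxtimes>\<^bsub>K\<^esub> X)) (twist_mid K U V W X W' V' \<Psi>)"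
  unfolding twist_mid_def by (rule lin_intros)+

text \<open>Applying \<open>e\<close> to the first two factors of \<open>u \<otimes> w\<^sup>\<Psi> \<otimes> v\<^sup>\<Psi> \<otimes> x\<close> leaves \<open>x\<close> untouched: the result is the
  left contraction of \<open>u \<otimes> v \<otimes> w\<close>, tensored with \<open>x\<close>.\<close>

lemma twist_mid_contract_left:
  assumes e: "linear_map K (U \<boxtimes>\<^bsub>K\<^esub> W') (ground_vs K) e"
    and t: "t \<in> carrier (U \<boxtimes>\<^bsub>K\<^esub> V \<boxtimes>\<^bsub>K\<^esub> (W \<boxtimes>\<^bsub>K\<^esub> X))"
  shows "lunit K (V' \<boxtimes>\<^bsub>K\<^esub> X) (tensor_map K (U \<boxtimes>\<^bsub>K\<^esub> W') (V' \<boxtimes>\<^bsub>K\<^esub> X) (ground_vs K) (V' \<boxtimes>\<^bsub>K\<^esub> X) e id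
      (twist_mid K U V W X W' V' \<Psi> t))
    = tensor_map K (U \<boxtimes>\<^bsub>K\<^esub> V \<boxtimes>\<^bsub>K\<^esub> W) X V' X (contract_left K U V W W' V' e \<Psi>) id
        (assoc_inv K (U \<boxtimes>\<^bsub>K\<^esub> V) W X t)"
proof -
  note R = linear_contract_left[OF e]
  note [simp] = e linear_map_closed[OF e, simplified]
  \<comment> \<open>\<open>\<Psi> (v \<otimes> w)\<close> need not be pure, so the claim is first proved with an arbitrary \<open>s\<close> in its place.\<close>
  have key: "lunit K (V' \<boxtimes>\<^bsub>K\<^esub> X) (tensor_map K (U \<boxtimes>\<^bsub>K\<^esub> W') (V' \<boxtimes>\<^bsub>K\<^esub> X) (ground_vs K) (V' \<boxtimes>\<^bsub>K\<^esub> X) e id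
      (split_mid K U W' V' X (pure_tensor K U (W' \<boxtimes>\<^bsub>K\<^esub> V' \<boxtimes>\<^bsub>K\<^esub> X) u (pure_tensor K (W' \<boxtimes>\<^bsub>K\<^esub> V') X s x))))
    = pure_tensor K V' X (lunit K V' (tensor_map K (U \<boxtimes>\<^bsub>K\<^esub> W') V' (ground_vs K) V' e id
      (assoc_inv K U W' V' (pure_tensor K U (W' \<boxtimes>\<^bsub>K\<^esub> V') u s)))) x"
    if u: "u \<in> carrier U" and x: "x \<in> carrier X" and s: "s \<in> carrier (W' \<boxtimes>\<^bsub>K\<^esub> V')" for u x s
  proof -
    have "(lunit K (V' \<boxtimes>\<^bsub>K\<^esub> X) \<circ> tensor_map K (U \<boxtimes>\<^bsub>K\<^esub> W') (V' \<boxtimes>\<^bsub>K\<^esub> X) (ground_vs K) (V' \<boxtimes>\<^bsub>K\<^esub> X) e id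
        \<circ> split_mid K U W' V' X \<circ> pure_tensor K U (W' \<boxtimes>\<^bsub>K\<^esub> V' \<boxtimes>\<^bsub>K\<^esub> X) u \<circ> (\<lambda>s. pure_tensor K (W' \<boxtimes>\<^bsub>K\<^esub> V') X s x)) s
      = ((\<lambda>v. pure_tensor K V' X v x) \<circ> lunit K V' \<circ> tensor_map K (U \<boxtimes>\<^bsub>K\<^esub> W') V' (ground_vs K) V' e id
        \<circ> assoc_inv K U W' V' \<circ> pure_tensor K U (W' \<boxtimes>\<^bsub>K\<^esub> V') u) s"
    proof (rule tensor_eqI[OF vs(5,6) _ _ _ s])
      fix w v assume "w \<in> carrier W'" "v \<in> carrier V'"
      then show "(lunit K (V' \<boxtimes>\<^bsub>K\<^esub> X) \<circ> tensor_map K (U \<boxtimes>\<^bsub>K\<^esub> W') (V' \<boxtimes>\<^bsub>K\<^esub> X) (ground_vs K) (V' \<boxtimes>\<^bsub>K\<^esub> X) e id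
        \<circ> split_mid K U W' V' X \<circ> pure_tensor K U (W' \<boxtimes>\<^bsub>K\<^esub> V' \<boxtimes>\<^bsub>K\<^esub> X) u \<circ> (\<lambda>s. pure_tensor K (W' \<boxtimes>\<^bsub>K\<^esub> V') X s x))
          (pure_tensor K W' V' w v)
      = ((\<lambda>v. pure_tensor K V' X v x) \<circ> lunit K V' \<circ> tensor_map K (U \<boxtimes>\<^bsub>K\<^esub> W') V' (ground_vs K) V' e id
        \<circ> assoc_inv K U W' V' \<circ> pure_tensor K U (W' \<boxtimes>\<^bsub>K\<^esub> V') u) (pure_tensor K W' V' w v)"
        using u x by (simp add: lin_simps linear_map_smult[OF linear_map_pure_left])
    qed (rule lin_intros e u x)+
    then show ?thesis by simp
  qed
  have "(lunit K (V' \<boxtimes>\<^bsub>K\<^esub> X) \<circ> tensor_map K (U \<boxtimes>\<^bsub>K\<^esub> W') (V' \<boxtimes>\<^bsub>K\<^esub> X) (ground_vs K) (V' \<boxtimes>\<^bsub>K\<^esub> X) e id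
      \<circ> twist_mid K U V W X W' V' \<Psi>) t
    = (tensor_map K (U \<boxtimes>\<^bsub>K\<^esub> V \<boxtimes>\<^bsub>K\<^esub> W) X V' X (contract_left K U V W W' V' e \<Psi>) id
        \<circ> assoc_inv K (U \<boxtimes>\<^bsub>K\<^esub> V) W X) t"
  proof (rule tensor_both_nested_eqI[OF vs(1-4) _ _ _ t])
    fix u v w x assume "u \<in> carrier U" "v \<in> carrier V" "w \<in> carrier W" "x \<in> carrier X"
    then show "(lunit K (V' \<boxtimes>\<^bsub>K\<^esub> X) \<circ> tensor_map K (U \<boxtimes>\<^bsub>K\<^esub> W') (V' \<boxtimes>\<^bsub>K\<^esub> X) (ground_vs K) (V' \<boxtimes>\<^bsub>K\<^esub> X) e id
      \<circ> twist_mid K U V W X W' V' \<Psi>)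
        (pure_tensor K (U \<boxtimes>\<^bsub>K\<^esub> V) (W \<boxtimes>\<^bsub>K\<^esub> X) (pure_tensor K U V u v) (pure_tensor K W X w x))
    = (tensor_map K (U \<boxtimes>\<^bsub>K\<^esub> V \<boxtimes>\<^bsub>K\<^esub> W) X V' X (contract_left K U V W W' V' e \<Psi>) id
        \<circ> assoc_inv K (U \<boxtimes>\<^bsub>K\<^esub> V) W X)
        (pure_tensor K (U \<boxtimes>\<^bsub>K\<^esub> V) (W \<boxtimes>\<^bsub>K\<^esub> X) (pure_tensor K U V u v) (pure_tensor K W X w x))"
      by (simp add: lin_simps key R) (simp add: twist_mid_def contract_left_def lin_simps key)
  qed (rule lin_intros e R linear_twist_mid)+
  then show ?thesis by simp
qed

text \<open>Here \<open>e\<close> meets the last two factors, and \<open>u\<close> is the spectator.\<close>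

lemma twist_mid_contract_right:
  assumes e: "linear_map K (V' \<boxtimes>\<^bsub>K\<^esub> X) (ground_vs K) e"
    and t: "t \<in> carrier (U \<boxtimes>\<^bsub>K\<^esub> V \<boxtimes>\<^bsub>K\<^esub> (W \<boxtimes>\<^bsub>K\<^esub> X))"
  shows "runit K (U \<boxtimes>\<^bsub>K\<^esub> W') (tensor_map K (U \<boxtimes>\<^bsub>K\<^esub> W') (V' \<boxtimes>\<^bsub>K\<^esub> X) (U \<boxtimes>\<^bsub>K\<^esub> W') (ground_vs K) id e
      (twist_mid K U V W X W' V' \<Psi> t))
    = tensor_map K U (V \<boxtimes>\<^bsub>K\<^esub> (W \<boxtimes>\<^bsub>K\<^esub> X)) U W' id (contract_right K V W X W' V' e \<Psi>)
        (assoc K U V (W \<boxtimes>\<^bsub>K\<^esub> X) t)"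
proof -
  note L = linear_contract_right[OF e]
  note [simp] = e linear_map_closed[OF e, simplified]
  \<comment> \<open>Again \<open>s\<close> stands for \<open>\<Psi> (v \<otimes> w)\<close>, which need not be pure.\<close>
  have key: "runit K (U \<boxtimes>\<^bsub>K\<^esub> W') (tensor_map K (U \<boxtimes>\<^bsub>K\<^esub> W') (V' \<boxtimes>\<^bsub>K\<^esub> X) (U \<boxtimes>\<^bsub>K\<^esub> W') (ground_vs K) id e
      (split_mid K U W' V' X (pure_tensor K U (W' \<boxtimes>\<^bsub>K\<^esub> V' \<boxtimes>\<^bsub>K\<^esub> X) u (pure_tensor K (W' \<boxtimes>\<^bsub>K\<^esub> V') X s x))))
    = pure_tensor K U W' u (runit K W' (tensor_map K W' (V' \<boxtimes>\<^bsub>K\<^esub> X) W' (ground_vs K) id e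
      (assoc K W' V' X (pure_tensor K (W' \<boxtimes>\<^bsub>K\<^esub> V') X s x))))"
    if u: "u \<in> carrier U" and x: "x \<in> carrier X" and s: "s \<in> carrier (W' \<boxtimes>\<^bsub>K\<^esub> V')" for u x s
  proof -
    have "(runit K (U \<boxtimes>\<^bsub>K\<^esub> W') \<circ> tensor_map K (U \<boxtimes>\<^bsub>K\<^esub> W') (V' \<boxtimes>\<^bsub>K\<^esub> X) (U \<boxtimes>\<^bsub>K\<^esub> W') (ground_vs K) id e
        \<circ> split_mid K U W' V' X \<circ> pure_tensor K U (W' \<boxtimes>\<^bsub>K\<^esub> V' \<boxtimes>\<^bsub>K\<^esub> X) u \<circ> (\<lambda>s. pure_tensor K (W' \<boxtimes>\<^bsub>K\<^esub> V') X s x)) s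
      = (pure_tensor K U W' u \<circ> runit K W' \<circ> tensor_map K W' (V' \<boxtimes>\<^bsub>K\<^esub> X) W' (ground_vs K) id e
        \<circ> assoc K W' V' X \<circ> (\<lambda>s. pure_tensor K (W' \<boxtimes>\<^bsub>K\<^esub> V') X s x)) s"
    proof (rule tensor_eqI[OF vs(5,6) _ _ _ s])
      fix w v assume "w \<in> carrier W'" "v \<in> carrier V'"
      then show "(runit K (U \<boxtimes>\<^bsub>K\<^esub> W') \<circ> tensor_map K (U \<boxtimes>\<^bsub>K\<^esub> W') (V' \<boxtimes>\<^bsub>K\<^esub> X) (U \<boxtimes>\<^bsub>K\<^esub> W') (ground_vs K) id e
        \<circ> split_mid K U W' V' X \<circ> pure_tensor K U (W' \<boxtimes>\<^bsub>K\<^esub> V' \<boxtimes>\<^bsub>K\<^esub> X) u \<circ> (\<lambda>s. pure_tensor K (W' \<boxtimes>\<^bsub>K\<^esub> V') X s x))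
          (pure_tensor K W' V' w v)
      = (pure_tensor K U W' u \<circ> runit K W' \<circ> tensor_map K W' (V' \<boxtimes>\<^bsub>K\<^esub> X) W' (ground_vs K) id e
        \<circ> assoc K W' V' X \<circ> (\<lambda>s. pure_tensor K (W' \<boxtimes>\<^bsub>K\<^esub> V') X s x)) (pure_tensor K W' V' w v)"
        using u x by (simp add: lin_simps linear_map_smult[OF linear_map_pure_right])
    qed (rule lin_intros e u x)+
    then show ?thesis by simp
  qed
  have "(runit K (U \<boxtimes>\<^bsub>K\<^esub> W') \<circ> tensor_map K (U \<boxtimes>\<^bsub>K\<^esub> W') (V' \<boxtimes>\<^bsub>K\<^esub> X) (U \<boxtimes>\<^bsub>K\<^esub> W') (ground_vs K) id e
      \<circ> twist_mid K U V W X W' V' \<Psi>) t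
    = (tensor_map K U (V \<boxtimes>\<^bsub>K\<^esub> (W \<boxtimes>\<^bsub>K\<^esub> X)) U W' id (contract_right K V W X W' V' e \<Psi>)
        \<circ> assoc K U V (W \<boxtimes>\<^bsub>K\<^esub> X)) t"
  proof (rule tensor_both_nested_eqI[OF vs(1-4) _ _ _ t])
    fix u v w x assume "u \<in> carrier U" "v \<in> carrier V" "w \<in> carrier W" "x \<in> carrier X"
    then show "(runit K (U \<boxtimes>\<^bsub>K\<^esub> W') \<circ> tensor_map K (U \<boxtimes>\<^bsub>K\<^esub> W') (V' \<boxtimes>\<^bsub>K\<^esub> X) (U \<boxtimes>\<^bsub>K\<^esub> W') (ground_vs K) id e
      \<circ> twist_mid K U V W X W' V' \<Psi>)
        (pure_tensor K (U \<boxtimes>\<^bsub>K\<^esub> V) (W \<boxtimes>\<^bsub>K\<^esub> X) (pure_tensor K U V u v) (pure_tensor K W X w x))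
    = (tensor_map K U (V \<boxtimes>\<^bsub>K\<^esub> (W \<boxtimes>\<^bsub>K\<^esub> X)) U W' id (contract_right K V W X W' V' e \<Psi>)
        \<circ> assoc K U V (W \<boxtimes>\<^bsub>K\<^esub> X))
        (pure_tensor K (U \<boxtimes>\<^bsub>K\<^esub> V) (W \<boxtimes>\<^bsub>K\<^esub> X) (pure_tensor K U V u v) (pure_tensor K W X w x))"
      by (simp add: lin_simps key L) (simp add: twist_mid_def contract_right_def lin_simps key)
  qed (rule lin_intros e L linear_twist_mid)+
  then show ?thesis by simp
qed

end

section \<open>Cofree comodules\<close>

text \<open>The space \<open>V \<otimes> D\<close> with coaction \<open>id \<otimes> \<Delta>\<close> is the cofree right comodule on \<open>V\<close>: a linear map
  \<open>r : V \<otimes> D \<rightarrow> V\<close> induces the endomorphism \<open>(r \<otimes> id) (id \<otimes> \<Delta>)\<close>, from which \<open>r\<close> is recovered by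
  composing with \<open>id \<otimes> \<epsilon>\<close>. The identity is the endomorphism induced by \<open>id \<otimes> \<epsilon>\<close>. One half of this is
  the left counit law of \<open>D\<close>, the other half the right one.\<close>

lemma cofree_right_identity_iff:
  assumes V: "vectorspace K V" and D: "coalgebra K D" and r: "linear_map K (V \<boxtimes>\<^bsub>K\<^esub> D) V r"
  shows "(\<forall>t\<in>carrier (V \<boxtimes>\<^bsub>K\<^esub> D). tensor_map K (V \<boxtimes>\<^bsub>K\<^esub> D) D V D r id
        (assoc_inv K V D D (tensor_map K V D V (D \<boxtimes>\<^bsub>K\<^esub> D) id \<Delta>\<^bsub>D\<^esub> t)) = t) \<longleftrightarrow>
      (\<forall>t\<in>carrier (V \<boxtimes>\<^bsub>K\<^esub> D). r t = runit K V (tensor_map K V D V (ground_vs K) id \<epsilon>\<^bsub>D\<^esub> t))"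
    (is "(\<forall>t\<in>?T. ?f t = t) \<longleftrightarrow> (\<forall>t\<in>?T. r t = ?p t)")
proof
  interpret D: coalgebra K D by (rule D)
  note vs = V D.vectorspace_axioms and \<Delta> = D.comult_linear and \<epsilon> = D.counit_linear
  note [simp] = V D.vectorspace_axioms D.field_axioms \<Delta> \<epsilon> r linear_map_closed[OF r]
    linear_map_closed[OF \<Delta>] linear_map_closed[OF \<epsilon>, simplified] linear_map_tensor_map
  note intros = linear_map_intros vs \<Delta> \<epsilon> r D.field_axioms
  have p: "linear_map K (V \<boxtimes>\<^bsub>K\<^esub> D) V (runit K V \<circ> tensor_map K V D V (ground_vs K) id \<epsilon>\<^bsub>D\<^esub>)"
    by (rule intros)+
  have f: "linear_map K (V \<boxtimes>\<^bsub>K\<^esub> D) (V \<boxtimes>\<^bsub>K\<^esub> D) (tensor_map K (V \<boxtimes>\<^bsub>K\<^esub> D) D V D r id \<circ>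
        assoc_inv K V D D \<circ> tensor_map K V D V (D \<boxtimes>\<^bsub>K\<^esub> D) id \<Delta>\<^bsub>D\<^esub>)"
    by (rule intros)+
  {
    assume eq: "\<forall>t\<in>?T. r t = ?p t"
    \<comment> \<open>\<open>\<Delta> d\<close> need not be pure, so it is replaced by an arbitrary \<open>s\<close>; the same is done below.\<close>
    have pure: "tensor_map K (V \<boxtimes>\<^bsub>K\<^esub> D) D V D r id (assoc_inv K V D D (pure_tensor K V (D \<boxtimes>\<^bsub>K\<^esub> D) v s))
      = pure_tensor K V D v (lunit K D (tensor_map K D D (ground_vs K) D \<epsilon>\<^bsub>D\<^esub> id s))"
      if v: "v \<in> carrier V" and s: "s \<in> carrier (D \<boxtimes>\<^bsub>K\<^esub> D)" for v s
    proof -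
      have "(tensor_map K (V \<boxtimes>\<^bsub>K\<^esub> D) D V D r id \<circ> assoc_inv K V D D \<circ> pure_tensor K V (D \<boxtimes>\<^bsub>K\<^esub> D) v) s
        = (pure_tensor K V D v \<circ> lunit K D \<circ> tensor_map K D D (ground_vs K) D \<epsilon>\<^bsub>D\<^esub> id) s"
      proof (rule tensor_eqI[OF vs(2,2) _ _ _ s], goal_cases)
        case (3 d d')
        then show ?case using v
          by (simp add: eq linear_map_smult[OF linear_map_pure_left] linear_map_smult[OF linear_map_pure_right])
      qed (rule intros v)+
      then show ?thesis by simp
    qed
    show "\<forall>t\<in>?T. ?f t = t"
    proof
      fix t assume t: "t \<in> ?T"
      have "(tensor_map K (V \<boxtimes>\<^bsub>K\<^esub> D) D V D r id \<circ>
        assoc_inv K V D D \<circ> tensor_map K V D V (D \<boxtimes>\<^bsub>K\<^esub> D) id \<Delta>\<^bsub>D\<^esub>) t = id t"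
      proof (rule tensor_eqI[OF vs f _ _ t], goal_cases)
        case (2 v d)
        then show ?case by (simp add: pure D.counital_left)
      qed (rule intros)+
      then show "?f t = t" by simp
    qed
  }
  {
    assume eq: "\<forall>t\<in>?T. ?f t = t"
    have pure: "?p (tensor_map K (V \<boxtimes>\<^bsub>K\<^esub> D) D V D r id (assoc_inv K V D D (pure_tensor K V (D \<boxtimes>\<^bsub>K\<^esub> D) v s)))
      = r (pure_tensor K V D v (runit K D (tensor_map K D D D (ground_vs K) id \<epsilon>\<^bsub>D\<^esub> s)))"
      if v: "v \<in> carrier V" and s: "s \<in> carrier (D \<boxtimes>\<^bsub>K\<^esub> D)" for v s
    proof -
      have "(runit K V \<circ> tensor_map K V D V (ground_vs K) id \<epsilon>\<^bsub>D\<^esub> \<circ>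
          tensor_map K (V \<boxtimes>\<^bsub>K\<^esub> D) D V D r id \<circ> assoc_inv K V D D \<circ> pure_tensor K V (D \<boxtimes>\<^bsub>K\<^esub> D) v) s
        = (r \<circ> pure_tensor K V D v \<circ> runit K D \<circ> tensor_map K D D D (ground_vs K) id \<epsilon>\<^bsub>D\<^esub>) s"
      proof (rule tensor_eqI[OF vs(2,2) _ _ _ s], goal_cases)
        case (3 d d')
        then show ?case using v
          by (simp add: linear_map_smult[OF r] linear_map_smult[OF linear_map_pure_right])
      qed (rule intros v)+
      then show ?thesis by simp
    qed
    have "?p (?f t) = r t" if t: "t \<in> ?T" for t
    proof -
      have "((runit K V \<circ> tensor_map K V D V (ground_vs K) id \<epsilon>\<^bsub>D\<^esub>) \<circ> (tensor_map K (V \<boxtimes>\<^bsub>K\<^esub> D) D V D r id \<circ>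
        assoc_inv K V D D \<circ> tensor_map K V D V (D \<boxtimes>\<^bsub>K\<^esub> D) id \<Delta>\<^bsub>D\<^esub>)) t = r t"
      proof (rule tensor_eqI[OF vs linear_map_comp[OF p f] r _ t], goal_cases)
        case (1 v d)
        then show ?case by (simp add: pure D.counital_right)
      qed
      then show ?thesis by simp
    qed
    then show "\<forall>t\<in>?T. r t = ?p t" using eq by simp
  }
qed

text \<open>The mirror image, for the cofree left comodule \<open>C \<otimes> W\<close>.\<close>

lemma cofree_left_identity_iff:
  assumes C: "coalgebra K C" and W: "vectorspace K W" and l: "linear_map K (C \<boxtimes>\<^bsub>K\<^esub> W) W l"
  shows "(\<forall>t\<in>carrier (C \<boxtimes>\<^bsub>K\<^esub> W). tensor_map K C (C \<boxtimes>\<^bsub>K\<^esub> W) C W id l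
        (assoc K C C W (tensor_map K C W (C \<boxtimes>\<^bsub>K\<^esub> C) W \<Delta>\<^bsub>C\<^esub> id t)) = t) \<longleftrightarrow>
      (\<forall>t\<in>carrier (C \<boxtimes>\<^bsub>K\<^esub> W). l t = lunit K W (tensor_map K C W (ground_vs K) W \<epsilon>\<^bsub>C\<^esub> id t))"
    (is "(\<forall>t\<in>?T. ?f t = t) \<longleftrightarrow> (\<forall>t\<in>?T. l t = ?p t)")
proof
  interpret C: coalgebra K C by (rule C)
  note vs = C.vectorspace_axioms W and \<Delta> = C.comult_linear and \<epsilon> = C.counit_linear
  note [simp] = W C.vectorspace_axioms C.field_axioms \<Delta> \<epsilon> l linear_map_closed[OF l]
    linear_map_closed[OF \<Delta>] linear_map_closed[OF \<epsilon>, simplified] linear_map_tensor_map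
  note intros = linear_map_intros vs \<Delta> \<epsilon> l C.field_axioms
  have p: "linear_map K (C \<boxtimes>\<^bsub>K\<^esub> W) W (lunit K W \<circ> tensor_map K C W (ground_vs K) W \<epsilon>\<^bsub>C\<^esub> id)"
    by (rule intros)+
  have f: "linear_map K (C \<boxtimes>\<^bsub>K\<^esub> W) (C \<boxtimes>\<^bsub>K\<^esub> W) (tensor_map K C (C \<boxtimes>\<^bsub>K\<^esub> W) C W id l \<circ>
        assoc K C C W \<circ> tensor_map K C W (C \<boxtimes>\<^bsub>K\<^esub> C) W \<Delta>\<^bsub>C\<^esub> id)"
    by (rule intros)+
  {
    assume eq: "\<forall>t\<in>?T. l t = ?p t"
    have pure: "tensor_map K C (C \<boxtimes>\<^bsub>K\<^esub> W) C W id l (assoc K C C W (pure_tensor K (C \<boxtimes>\<^bsub>K\<^esub> C) W s w))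
      = pure_tensor K C W (runit K C (tensor_map K C C C (ground_vs K) id \<epsilon>\<^bsub>C\<^esub> s)) w"
      if w: "w \<in> carrier W" and s: "s \<in> carrier (C \<boxtimes>\<^bsub>K\<^esub> C)" for w s
    proof -
      have "(tensor_map K C (C \<boxtimes>\<^bsub>K\<^esub> W) C W id l \<circ> assoc K C C W \<circ> (\<lambda>s. pure_tensor K (C \<boxtimes>\<^bsub>K\<^esub> C) W s w)) s
        = ((\<lambda>c. pure_tensor K C W c w) \<circ> runit K C \<circ> tensor_map K C C C (ground_vs K) id \<epsilon>\<^bsub>C\<^esub>) s"
      proof (rule tensor_eqI[OF vs(1,1) _ _ _ s], goal_cases)
        case (3 c c')
        then show ?case using w
          by (simp add: eq linear_map_smult[OF linear_map_pure_left] linear_map_smult[OF linear_map_pure_right])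
      qed (rule intros w)+
      then show ?thesis by simp
    qed
    show "\<forall>t\<in>?T. ?f t = t"
    proof
      fix t assume t: "t \<in> ?T"
      have "(tensor_map K C (C \<boxtimes>\<^bsub>K\<^esub> W) C W id l \<circ>
        assoc K C C W \<circ> tensor_map K C W (C \<boxtimes>\<^bsub>K\<^esub> C) W \<Delta>\<^bsub>C\<^esub> id) t = id t"
      proof (rule tensor_eqI[OF vs f _ _ t], goal_cases)
        case (2 c w)
        then show ?case by (simp add: pure C.counital_right)
      qed (rule intros)+
      then show "?f t = t" by simp
    qed
  }
  {
    assume eq: "\<forall>t\<in>?T. ?f t = t"
    have pure: "?p (tensor_map K C (C \<boxtimes>\<^bsub>K\<^esub> W) C W id l (assoc K C C W (pure_tensor K (C \<boxtimes>\<^bsub>K\<^esub> C) W s w)))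
      = l (pure_tensor K C W (lunit K C (tensor_map K C C (ground_vs K) C \<epsilon>\<^bsub>C\<^esub> id s)) w)"
      if w: "w \<in> carrier W" and s: "s \<in> carrier (C \<boxtimes>\<^bsub>K\<^esub> C)" for w s
    proof -
      have "(lunit K W \<circ> tensor_map K C W (ground_vs K) W \<epsilon>\<^bsub>C\<^esub> id \<circ>
          tensor_map K C (C \<boxtimes>\<^bsub>K\<^esub> W) C W id l \<circ> assoc K C C W \<circ> (\<lambda>s. pure_tensor K (C \<boxtimes>\<^bsub>K\<^esub> C) W s w)) s
        = (l \<circ> (\<lambda>c. pure_tensor K C W c w) \<circ> lunit K C \<circ> tensor_map K C C (ground_vs K) C \<epsilon>\<^bsub>C\<^esub> id) s"
      proof (rule tensor_eqI[OF vs(1,1) _ _ _ s], goal_cases)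
        case (3 c c')
        then show ?case using w
          by (simp add: linear_map_smult[OF l] linear_map_smult[OF linear_map_pure_left])
      qed (rule intros w)+
      then show ?thesis by simp
    qed
    have "?p (?f t) = l t" if t: "t \<in> ?T" for t
    proof -
      have "((lunit K W \<circ> tensor_map K C W (ground_vs K) W \<epsilon>\<^bsub>C\<^esub> id) \<circ> (tensor_map K C (C \<boxtimes>\<^bsub>K\<^esub> W) C W id l \<circ>
        assoc K C C W \<circ> tensor_map K C W (C \<boxtimes>\<^bsub>K\<^esub> C) W \<Delta>\<^bsub>C\<^esub> id)) t = l t"
      proof (rule tensor_eqI[OF vs linear_map_comp[OF p f] l _ t], goal_cases)
        case (1 c w)
        then show ?case by (simp add: pure C.counital_left)
      qed
      then show ?thesis by simp
    qed
    then show "\<forall>t\<in>?T. l t = ?p t" using eq by simp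
  }
qed

section \<open>Conormality and counits\<close>

theorem proposition3p4:
  fixes K :: "('a, 'm) ring_scheme"
    and C :: "('a, 'c, 'n) coalgebra_scheme"
    and D :: "('a, 'd, 'p) coalgebra_scheme"
    and \<Psi> Z :: "('a, 'c, 'd) tensor \<Rightarrow> ('a, 'd, 'c) tensor"
  assumes "field K"
    and "coalgebra K C"
    and "coalgebra K D"
    and "linear_map K (C \<boxtimes>\<^bsub>K\<^esub> D) (D \<boxtimes>\<^bsub>K\<^esub> C) \<Psi>"
    and "twist_coassociative K C D \<Psi>"
    and "linear_map K (C \<boxtimes>\<^bsub>K\<^esub> D) (D \<boxtimes>\<^bsub>K\<^esub> C) Z"
  shows "conormal K C D Z \<Psi> \<longleftrightarrow>
    is_counit_for K (C \<boxtimes>\<^bsub>K\<^esub> D) (twisted_comult K C D \<Psi>) (counit_tensor K D C \<circ> Z)"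
proof -
  interpret C: coalgebra K C by (rule assms(2))
  interpret D: coalgebra K D by (rule assms(3))
  note \<Psi> = assms(4) and Z = assms(6)
  note vs = C.vectorspace_axioms D.vectorspace_axioms and fld = assms(1)
  note \<Delta>C = C.comult_linear and \<epsilon>C = C.counit_linear and \<Delta>D = D.comult_linear and \<epsilon>D = D.counit_linear
  note intros = linear_map_intros vs fld \<Delta>C \<epsilon>C \<Delta>D \<epsilon>D \<Psi> Z
  note [simp] = vs fld
  interpret tw: twisted_contraction K C C D D D C \<Psi> by (rule twisted_contraction.intro) (rule vs \<Psi>)+
  let ?e = "counit_tensor K D C \<circ> Z"
  let ?T = "carrier (C \<boxtimes>\<^bsub>K\<^esub> D)"
  let ?\<Delta>C = "tensor_map K C D (C \<boxtimes>\<^bsub>K\<^esub> C) D \<Delta>\<^bsub>C\<^esub> id"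
  let ?\<Delta>D = "tensor_map K C D C (D \<boxtimes>\<^bsub>K\<^esub> D) id \<Delta>\<^bsub>D\<^esub>"
  let ?R = "contract_left K C C D D C ?e \<Psi>"
  let ?L = "contract_right K C D D D C ?e \<Psi>"
  have \<epsilon>: "linear_map K (D \<boxtimes>\<^bsub>K\<^esub> C) (ground_vs K) (counit_tensor K D C)"
    unfolding counit_tensor_def by (rule intros)+
  have e: "linear_map K (C \<boxtimes>\<^bsub>K\<^esub> D) (ground_vs K) ?e" by (rule intros \<epsilon>)+
  have R: "linear_map K (C \<boxtimes>\<^bsub>K\<^esub> D) C (?R \<circ> ?\<Delta>C)"
    by (rule e tw.linear_contract_left intros)+
  have L: "linear_map K (C \<boxtimes>\<^bsub>K\<^esub> D) D (?L \<circ> ?\<Delta>D)"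
    by (rule e tw.linear_contract_right intros)+
  have \<Delta>C_closed: "?\<Delta>C t \<in> carrier (C \<boxtimes>\<^bsub>K\<^esub> C \<boxtimes>\<^bsub>K\<^esub> D)" if "t \<in> ?T" for t
    by (rule linear_map_closed[OF _ that]) (rule intros)+
  have \<Delta>D_closed: "?\<Delta>D t \<in> carrier (C \<boxtimes>\<^bsub>K\<^esub> (D \<boxtimes>\<^bsub>K\<^esub> D))" if "t \<in> ?T" for t
    by (rule linear_map_closed[OF _ that]) (rule intros)+
  \<comment> \<open>The coproduct that the contraction consumes is applied last, so that naturality can move it.\<close>
  have split: "tensor_map K C D (C \<boxtimes>\<^bsub>K\<^esub> C) (D \<boxtimes>\<^bsub>K\<^esub> D) \<Delta>\<^bsub>C\<^esub> \<Delta>\<^bsub>D\<^esub> t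
      = tensor_map K C (D \<boxtimes>\<^bsub>K\<^esub> D) (C \<boxtimes>\<^bsub>K\<^esub> C) (D \<boxtimes>\<^bsub>K\<^esub> D) \<Delta>\<^bsub>C\<^esub> id (?\<Delta>D t)"
    "tensor_map K C D (C \<boxtimes>\<^bsub>K\<^esub> C) (D \<boxtimes>\<^bsub>K\<^esub> D) \<Delta>\<^bsub>C\<^esub> \<Delta>\<^bsub>D\<^esub> t
      = tensor_map K (C \<boxtimes>\<^bsub>K\<^esub> C) D (C \<boxtimes>\<^bsub>K\<^esub> C) (D \<boxtimes>\<^bsub>K\<^esub> D) id \<Delta>\<^bsub>D\<^esub> (?\<Delta>C t)"
    if t: "t \<in> ?T" for t
    by (subst tensor_map_comp[OF _ _ _ _ t], (rule intros)+, simp)+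
  have tw_def: "twisted_comult K C D \<Psi> t = twist_mid K C C D D D C \<Psi>
      (tensor_map K C D (C \<boxtimes>\<^bsub>K\<^esub> C) (D \<boxtimes>\<^bsub>K\<^esub> D) \<Delta>\<^bsub>C\<^esub> \<Delta>\<^bsub>D\<^esub> t)" for t
    by (simp add: twisted_comult_def twist_mid_def)
  have \<Delta>\<Delta>: "tensor_map K C D (C \<boxtimes>\<^bsub>K\<^esub> C) (D \<boxtimes>\<^bsub>K\<^esub> D) \<Delta>\<^bsub>C\<^esub> \<Delta>\<^bsub>D\<^esub> t
      \<in> carrier (C \<boxtimes>\<^bsub>K\<^esub> C \<boxtimes>\<^bsub>K\<^esub> (D \<boxtimes>\<^bsub>K\<^esub> D))" if "t \<in> ?T" for t
    by (rule linear_map_closed[OF _ that]) (rule intros)+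
  have left: "lunit K (C \<boxtimes>\<^bsub>K\<^esub> D) (tensor_map K (C \<boxtimes>\<^bsub>K\<^esub> D) (C \<boxtimes>\<^bsub>K\<^esub> D) (ground_vs K) (C \<boxtimes>\<^bsub>K\<^esub> D) ?e id
        (twisted_comult K C D \<Psi> t))
      = tensor_map K (C \<boxtimes>\<^bsub>K\<^esub> D) D C D (?R \<circ> ?\<Delta>C) id (assoc_inv K C D D (?\<Delta>D t))"
    if t: "t \<in> ?T" for t
  proof -
    have closed: "assoc_inv K C D D (?\<Delta>D t) \<in> carrier (C \<boxtimes>\<^bsub>K\<^esub> D \<boxtimes>\<^bsub>K\<^esub> D)"
      by (rule linear_map_closed[OF linear_map_assoc_inv \<Delta>D_closed[OF t]]) (rule vs)+
    show ?thesis
      unfolding tw_def tw.twist_mid_contract_left[OF e \<Delta>\<Delta>[OF t]]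
      unfolding split(1)[OF t] assoc_inv_natural[OF \<Delta>C vs(2,2) \<Delta>D_closed[OF t]]
        tensor_map_comp[OF linear_map_tensor_map[OF \<Delta>C linear_map_id[OF vs(2)]] linear_map_id[OF vs(2)]
          tw.linear_contract_left[OF e] linear_map_id[OF vs(2)] closed] id_comp
      by (rule refl)
  qed
  have right: "runit K (C \<boxtimes>\<^bsub>K\<^esub> D) (tensor_map K (C \<boxtimes>\<^bsub>K\<^esub> D) (C \<boxtimes>\<^bsub>K\<^esub> D) (C \<boxtimes>\<^bsub>K\<^esub> D) (ground_vs K) id ?e
        (twisted_comult K C D \<Psi> t))
      = tensor_map K C (C \<boxtimes>\<^bsub>K\<^esub> D) C D id (?L \<circ> ?\<Delta>D) (assoc K C C D (?\<Delta>C t))"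
    if t: "t \<in> ?T" for t
  proof -
    have closed: "assoc K C C D (?\<Delta>C t) \<in> carrier (C \<boxtimes>\<^bsub>K\<^esub> (C \<boxtimes>\<^bsub>K\<^esub> D))"
      by (rule linear_map_closed[OF linear_map_assoc \<Delta>C_closed[OF t]]) (rule vs)+
    show ?thesis
      unfolding tw_def tw.twist_mid_contract_right[OF e \<Delta>\<Delta>[OF t]]
      unfolding split(2)[OF t] assoc_natural[OF vs(1,1) \<Delta>D \<Delta>C_closed[OF t]]
        tensor_map_comp[OF linear_map_id[OF vs(1)] linear_map_tensor_map[OF linear_map_id[OF vs(1)] \<Delta>D]
          linear_map_id[OF vs(1)] tw.linear_contract_right[OF e] closed] id_comp
      by (rule refl)
  qed
  \<comment> \<open>The composites in the definitions apply \<open>Z\<close> and \<open>\<epsilon>\<^sub>D \<otimes> \<epsilon>\<^sub>C\<close> in two steps; \<open>?e\<close> fuses them.\<close>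
  have R_eq: "(lunit K C
      \<circ> tensor_map K (D \<boxtimes>\<^bsub>K\<^esub> C) C (ground_vs K) C (counit_tensor K D C) id
      \<circ> tensor_map K (C \<boxtimes>\<^bsub>K\<^esub> D) C (D \<boxtimes>\<^bsub>K\<^esub> C) C Z id
      \<circ> assoc_inv K C D C
      \<circ> tensor_map K C (C \<boxtimes>\<^bsub>K\<^esub> D) C (D \<boxtimes>\<^bsub>K\<^esub> C) id \<Psi>
      \<circ> assoc K C C D
      \<circ> ?\<Delta>C) t = (?R \<circ> ?\<Delta>C) t" if t: "t \<in> ?T" for t
  proof -
    have "(assoc_inv K C D C \<circ> tensor_map K C (C \<boxtimes>\<^bsub>K\<^esub> D) C (D \<boxtimes>\<^bsub>K\<^esub> C) id \<Psi> \<circ> assoc K C C D \<circ> ?\<Delta>C) t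
      \<in> carrier (C \<boxtimes>\<^bsub>K\<^esub> D \<boxtimes>\<^bsub>K\<^esub> C)"
      by (rule linear_map_closed[OF _ t]) (rule intros)+
    from tensor_map_comp[OF Z linear_map_id[OF vs(1)] \<epsilon> linear_map_id[OF vs(1)] this]
    show ?thesis by (simp only: contract_left_def comp_apply id_comp)
  qed
  have L_eq: "(runit K D
      \<circ> tensor_map K D (D \<boxtimes>\<^bsub>K\<^esub> C) D (ground_vs K) id (counit_tensor K D C)
      \<circ> tensor_map K D (C \<boxtimes>\<^bsub>K\<^esub> D) D (D \<boxtimes>\<^bsub>K\<^esub> C) id Z
      \<circ> assoc K D C D
      \<circ> tensor_map K (C \<boxtimes>\<^bsub>K\<^esub> D) D (D \<boxtimes>\<^bsub>K\<^esub> C) D \<Psi> id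
      \<circ> assoc_inv K C D D
      \<circ> ?\<Delta>D) t = (?L \<circ> ?\<Delta>D) t" if t: "t \<in> ?T" for t
  proof -
    have "(assoc K D C D \<circ> tensor_map K (C \<boxtimes>\<^bsub>K\<^esub> D) D (D \<boxtimes>\<^bsub>K\<^esub> C) D \<Psi> id \<circ> assoc_inv K C D D \<circ> ?\<Delta>D) t
      \<in> carrier (D \<boxtimes>\<^bsub>K\<^esub> (C \<boxtimes>\<^bsub>K\<^esub> D))"
      by (rule linear_map_closed[OF _ t]) (rule intros)+
    from tensor_map_comp[OF linear_map_id[OF vs(2)] Z linear_map_id[OF vs(2)] \<epsilon> this]
    show ?thesis by (simp only: contract_right_def comp_apply id_comp)
  qed
  have "right_conormal K C D Z \<Psi> \<longleftrightarrow>
      (\<forall>t\<in>?T. (?R \<circ> ?\<Delta>C) t = runit K C (tensor_map K C D C (ground_vs K) id \<epsilon>\<^bsub>D\<^esub> t))"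
    unfolding right_conormal_def comp_apply[of "runit K C"]
    by (rule ball_cong[OF refl]) (rule arg_cong2[OF R_eq refl])
  also have "\<dots> \<longleftrightarrow> (\<forall>t\<in>?T. tensor_map K (C \<boxtimes>\<^bsub>K\<^esub> D) D C D (?R \<circ> ?\<Delta>C) id (assoc_inv K C D D (?\<Delta>D t)) = t)"
    by (rule cofree_right_identity_iff[OF vs(1) assms(3) R, symmetric])
  also have "\<dots> \<longleftrightarrow> (\<forall>t\<in>?T. lunit K (C \<boxtimes>\<^bsub>K\<^esub> D)
      (tensor_map K (C \<boxtimes>\<^bsub>K\<^esub> D) (C \<boxtimes>\<^bsub>K\<^esub> D) (ground_vs K) (C \<boxtimes>\<^bsub>K\<^esub> D) ?e id (twisted_comult K C D \<Psi> t)) = t)"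
    by (rule ball_cong[OF refl]) (simp only: left)
  finally have 1: "right_conormal K C D Z \<Psi> \<longleftrightarrow> (\<forall>t\<in>?T. lunit K (C \<boxtimes>\<^bsub>K\<^esub> D)
      (tensor_map K (C \<boxtimes>\<^bsub>K\<^esub> D) (C \<boxtimes>\<^bsub>K\<^esub> D) (ground_vs K) (C \<boxtimes>\<^bsub>K\<^esub> D) ?e id (twisted_comult K C D \<Psi> t)) = t)" .
  have "left_conormal K C D Z \<Psi> \<longleftrightarrow>
      (\<forall>t\<in>?T. (?L \<circ> ?\<Delta>D) t = lunit K D (tensor_map K C D (ground_vs K) D \<epsilon>\<^bsub>C\<^esub> id t))"
    unfolding left_conormal_def comp_apply[of "lunit K D"]
    by (rule ball_cong[OF refl]) (rule arg_cong2[OF L_eq refl])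
  also have "\<dots> \<longleftrightarrow> (\<forall>t\<in>?T. tensor_map K C (C \<boxtimes>\<^bsub>K\<^esub> D) C D id (?L \<circ> ?\<Delta>D) (assoc K C C D (?\<Delta>C t)) = t)"
    by (rule cofree_left_identity_iff[OF assms(2) vs(2) L, symmetric])
  also have "\<dots> \<longleftrightarrow> (\<forall>t\<in>?T. runit K (C \<boxtimes>\<^bsub>K\<^esub> D)
      (tensor_map K (C \<boxtimes>\<^bsub>K\<^esub> D) (C \<boxtimes>\<^bsub>K\<^esub> D) (C \<boxtimes>\<^bsub>K\<^esub> D) (ground_vs K) id ?e (twisted_comult K C D \<Psi> t)) = t)"
    by (rule ball_cong[OF refl]) (simp only: right)
  finally have "left_conormal K C D Z \<Psi> \<longleftrightarrow> (\<forall>t\<in>?T. runit K (C \<boxtimes>\<^bsub>K\<^esub> D)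
      (tensor_map K (C \<boxtimes>\<^bsub>K\<^esub> D) (C \<boxtimes>\<^bsub>K\<^esub> D) (C \<boxtimes>\<^bsub>K\<^esub> D) (ground_vs K) id ?e (twisted_comult K C D \<Psi> t)) = t)" .
  with 1 show ?thesis
    unfolding conormal_def is_counit_for_def by blast
qed

end
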